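(* Let $T$ be the tree with vertex set $\{1,\dots,7\}$ and edges $[1,2],[2,3],[3,4],[4,5],[3,6],[6,7]$, and let $P=\{(0,\infty),(1,4)\}$. Then the preimage $$\mathbf{data}_P=\{z\in\mathbb{R}^7:\mathrm{PH}_0(z)=P\}$$ is homotopy equivalent to $S^1$.
   Context: A vector $z\in\mathbb{R}^7$ is viewed as a function on the vertices of $T$, extended to edges by taking the maximum over the two endpoints. For $r\in\mathbb{R}$, $T_r(z)$ is the subcomplex consisting of vertices $i$ with $z_i\le r$ and edges $[i,j]$ with $\max\{z_i,z_j\}\le r$. $\mathrm{PH}_0(z)$ denotes the degree-$0$ persistence diagram (multiset of (birth, death) pairs, with death possibly $\infty$) of the sublevel-set filtration $r\mapsto T_r(z)$. $\mathbf{data}_P$ carries the subspace topology from $\mathbb{R}^7$. *)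

theory Defs
  imports "HOL-Analysis.Analysis" "HOL-Library.Multiset" "HOL-Library.Extended_Real"
begin

definition T_vertices :: "nat set" where
  "T_vertices = {1..7}"

definition T_edges :: "(nat \<times> nat) set" where
  "T_edges = {(1,2),(2,3),(3,4),(4,5),(3,6),(6,7)}"

text \<open>Value of z at vertex i (i in 1..7); coordinate i of z is index i-1 of the numeral type 7.\<close>
definition zv :: "real^7 \<Rightarrow> nat \<Rightarrow> real" where
  "zv z i = z $ (of_nat (i - 1))"

definition sub_adj :: "real^7 \<Rightarrow> real \<Rightarrow> nat \<Rightarrow> nat \<Rightarrow> bool" where
  "sub_adj z r i j \<longleftrightarrow> ((i,j) \<in> T_edges \<or> (j,i) \<in> T_edges) \<and> max (zv z i) (zv z j) \<le> r"

definition sub_comp :: "real^7 \<Rightarrow> real \<Rightarrow> nat \<Rightarrow> nat set" where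
  "sub_comp z s v = {w. (sub_adj z s)\<^sup>*\<^sup>* v w}"

text \<open>Rank of the map H_0(T_r(z)) -> H_0(T_s(z)) induced by inclusion (r <= s):
  the number of connected components of T_s(z) containing a vertex of T_r(z).\<close>
definition rank0 :: "real^7 \<Rightarrow> real \<Rightarrow> real \<Rightarrow> nat" where
  "rank0 z r s = card (sub_comp z s ` {v \<in> T_vertices. zv z v \<le> r})"

text \<open>Degree-0 persistence diagram: the (unique) finite multiset of off-diagonal points (b,d), b < d,
  d possibly infinite, whose rank invariant is that of the filtration: for all r <= s the number of
  points with b <= r and d > s equals rank(H_0(T_r) -> H_0(T_s)).\<close>
definition PH0 :: "real^7 \<Rightarrow> (real \<times> ereal) multiset" where
  "PH0 z = (THE D. (\<forall>p\<in>#D. ereal (fst p) < snd p) \<and>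
      (\<forall>r s. r \<le> s \<longrightarrow> size (filter_mset (\<lambda>p. fst p \<le> r \<and> ereal s < snd p) D) = rank0 z r s))"

definition P_diag :: "(real \<times> ereal) multiset" where
  "P_diag = {#(0, \<infinity>), (1, ereal 4)#}"

definition data_P :: "(real^7) set" where
  "data_P = {z. PH0 z = P_diag}"

end

theory Submission
  imports Defs
begin

text \<open>
  A function in \<open>data_P\<close> has two valleys, of depths \<open>0\<close> and \<open>1\<close>, separated by the value \<open>4\<close>, so
  \<open>data_P\<close> behaves like the configuration space of two distinguishable points on a tripod.
  Listing the positions of the valleys describes \<open>data_P\<close> by linear inequalities in the
  seven values. Two straight-line homotopies retract it onto functions determined by the centre
  value and by the arms carrying the valleys: the first lowers each leaf to its neighbour
  where that is smaller, the second makes the remaining freedom depend on the centre value alone.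
  Measuring the values below \<open>4\<close> positively in the valley of depth \<open>0\<close> and
  negatively in that of depth \<open>1\<close>, the three leaves give a homeomorphism of the retract
  with the hexagon of points of the cube \<open>[-1,1]\<^sup>3\<close> having maximum \<open>1\<close> and minimum \<open>-1\<close>; the
  signed centre value is the sum of the three coordinates. Projecting the hexagon along the
  diagonal of the cube gives a circle.
\<close>

section \<open>Persistence diagrams and rank invariants\<close>

definition rank_invariant :: "(real \<times> ereal) multiset \<Rightarrow> real \<Rightarrow> real \<Rightarrow> nat" where
  "rank_invariant D r s = size (filter_mset (\<lambda>p. fst p \<le> r \<and> ereal s < snd p) D)"

definition off_diagonal :: "(real \<times> ereal) multiset \<Rightarrow> bool" where
  "off_diagonal D \<longleftrightarrow> (\<forall>p\<in>#D. ereal (fst p) < snd p)"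

text \<open>Cancelling the common part leaves disjoint \<open>A\<close> and \<open>B\<close> with
  equal rank invariants. Among their points take the least birth \<open>b\<close> and, for this
  birth, the greatest death \<open>d\<close>. For \<open>s\<close> slightly below \<open>d\<close>
  the rank at \<open>(b, s)\<close> counts the copies of \<open>(b, d)\<close> and nothing else, so
  \<open>A\<close> and \<open>B\<close> contain it equally often.\<close>

lemma rank_invariant_inj:
  assumes "off_diagonal D" "off_diagonal D'"
    and eq: "\<And>r s. r \<le> s \<Longrightarrow> rank_invariant D r s = rank_invariant D' r s"
  shows "D = D'"
proof (rule ccontr)
  assume "D \<noteq> D'"
  define A where "A = D - D'"
  define B where "B = D' - D"
  define S where "S = set_mset A \<union> set_mset B"
  have disj: "count A p = 0 \<or> count B p = 0" for p
    by (auto simp: A_def B_def)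
  have D: "D = (D \<inter># D') + A" and D': "D' = (D \<inter># D') + B"
    by (auto simp: A_def B_def multiset_eq_iff)
  have eqAB: "rank_invariant A r s = rank_invariant B r s" if "r \<le> s" for r s
  proof -
    have "rank_invariant D r s = rank_invariant (D \<inter># D') r s + rank_invariant A r s"
      unfolding rank_invariant_def by (subst D) (simp del: filter_inter_mset)
    moreover have "rank_invariant D' r s = rank_invariant (D \<inter># D') r s + rank_invariant B r s"
      unfolding rank_invariant_def by (subst D') (simp del: filter_inter_mset)
    ultimately show ?thesis using eq[OF that] by simp
  qed
  have "finite S" by (simp add: S_def)
  have "S \<noteq> {}" using \<open>D \<noteq> D'\<close> D D' by (auto simp: S_def)
  have offS: "ereal (fst p) < snd p" if "p \<in> S" for p
    using assms(1,2) that by (auto simp: S_def A_def B_def off_diagonal_def dest: in_diffD)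
  define b where "b = Min (fst ` S)"
  have b_le: "b \<le> fst p" if "p \<in> S" for p
    using \<open>finite S\<close> that by (simp add: b_def)
  define Sb where "Sb = {p \<in> S. fst p = b}"
  have "b \<in> fst ` S" unfolding b_def using \<open>finite S\<close> \<open>S \<noteq> {}\<close> by (intro Min_in) auto
  hence "Sb \<noteq> {}" by (auto simp: Sb_def)
  have "finite Sb" using \<open>finite S\<close> by (simp add: Sb_def)
  define d where "d = Max (snd ` Sb)"
  have "d \<in> snd ` Sb" unfolding d_def using \<open>finite Sb\<close> \<open>Sb \<noteq> {}\<close> by (intro Max_in) auto
  hence bd: "(b, d) \<in> S" by (auto simp: Sb_def)
  have d_ge: "snd p \<le> d" if "p \<in> Sb" for p
    using \<open>finite Sb\<close> that by (simp add: d_def)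
  have "ereal b < d" using offS[OF bd] by simp
  \<comment> \<open>The maximum of \<open>E\<close> lies in \<open>[b, d)\<close> and is not below
    any other death at birth \<open>b\<close>; it serves as the level \<open>s\<close>.\<close>
  define E where "E = insert (ereal b) (snd ` {p \<in> Sb. snd p \<noteq> d})"
  have "finite E" using \<open>finite Sb\<close> by (simp add: E_def)
  have "Max E \<in> E" using \<open>finite E\<close> by (intro Max_in) (auto simp: E_def)
  hence "Max E < d" using \<open>ereal b < d\<close> d_ge unfolding E_def by fastforce
  moreover have "ereal b \<le> Max E" using \<open>finite E\<close> by (auto simp: E_def)
  ultimately obtain s where s: "Max E = ereal s" by (cases "Max E") auto
  have "b \<le> s" "ereal s < d" using \<open>ereal b \<le> Max E\<close> \<open>Max E < d\<close> s by auto
  have E_le: "e \<le> ereal s" if "e \<in> E" for e using Max_ge[OF \<open>finite E\<close> that] s by simp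
  have key: "fst p \<le> b \<and> ereal s < snd p \<longleftrightarrow> p = (b, d)" if "p \<in> S" for p
  proof
    assume p: "fst p \<le> b \<and> ereal s < snd p"
    hence "p \<in> Sb" using b_le[OF that] that by (auto simp: Sb_def)
    have "snd p = d"
    proof (rule ccontr)
      assume "snd p \<noteq> d"
      hence "snd p \<in> E" using \<open>p \<in> Sb\<close> by (auto simp: E_def)
      with E_le p show False by force
    qed
    with \<open>p \<in> Sb\<close> show "p = (b, d)" by (auto simp: Sb_def prod_eq_iff)
  qed (use \<open>ereal s < d\<close> in auto)
  have "rank_invariant A b s = count A (b, d)"
  proof -
    have "filter_mset (\<lambda>p. fst p \<le> b \<and> ereal s < snd p) A = filter_mset (\<lambda>p. p = (b,d)) A"
      by (intro filter_mset_cong refl key) (auto simp: S_def)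
    thus ?thesis by (simp add: rank_invariant_def filter_eq_replicate_mset)
  qed
  moreover have "rank_invariant B b s = count B (b, d)"
  proof -
    have "filter_mset (\<lambda>p. fst p \<le> b \<and> ereal s < snd p) B = filter_mset (\<lambda>p. p = (b,d)) B"
      by (intro filter_mset_cong refl key) (auto simp: S_def)
    thus ?thesis by (simp add: rank_invariant_def filter_eq_replicate_mset)
  qed
  ultimately have "count A (b,d) = count B (b,d)" using eqAB[OF \<open>b \<le> s\<close>] by simp
  with disj[of "(b,d)"] bd show False
    by (auto simp: S_def count_eq_zero_iff) (metis count_eq_zero_iff)+
qed

section \<open>Components of sublevel sets and the elder rule\<close>

abbreviation linked :: "real^7 \<Rightarrow> real \<Rightarrow> nat \<Rightarrow> nat \<Rightarrow> bool" where
  "linked z s \<equiv> (sub_adj z s)\<^sup>*\<^sup>*"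

lemma linked_sym: "linked z s u v \<Longrightarrow> linked z s v u"
proof -
  have "symp (sub_adj z s)" by (auto simp: symp_def sub_adj_def max.commute)
  thus "linked z s u v \<Longrightarrow> linked z s v u" by (meson sympD symp_rtranclp)
qed

lemma linked_mono: "linked z s u v \<Longrightarrow> s \<le> t \<Longrightarrow> linked z t u v"
  by (rule rtranclp_mono[THEN predicate2D]) (auto simp: sub_adj_def)

lemma sub_adj_in_vertices: "sub_adj z s u v \<Longrightarrow> u \<in> T_vertices \<and> v \<in> T_vertices"
  by (auto simp: sub_adj_def T_edges_def T_vertices_def)

lemma linked_in_vertices: "linked z s u v \<Longrightarrow> u \<in> T_vertices \<Longrightarrow> v \<in> T_vertices"
  by (induction rule: rtranclp_induct) (auto dest: sub_adj_in_vertices)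

lemma linked_le: "linked z s u v \<Longrightarrow> u \<noteq> v \<Longrightarrow> zv z u \<le> s"
  by (auto elim: converse_rtranclpE simp: sub_adj_def)

lemma sub_comp_eq_iff: "sub_comp z s u = sub_comp z s v \<longleftrightarrow> linked z s u v"
  unfolding sub_comp_def set_eq_iff mem_Collect_eq
  by (meson linked_sym rtranclp.rtrancl_refl rtranclp_trans)

lemma finite_T_vertices: "finite T_vertices"
  by (simp add: T_vertices_def)

text \<open>Ties are broken by the vertex number, so that every component has exactly one oldest
  vertex.\<close>

definition older :: "real^7 \<Rightarrow> nat \<Rightarrow> nat \<Rightarrow> bool" where
  "older z v w \<longleftrightarrow> zv z v < zv z w \<or> (zv z v = zv z w \<and> v < w)"

text \<open>A vertex whose value exceeds \<open>s\<close> is linked only to itself and hence counts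
  as alive; this makes the predicate antitone in \<open>s\<close>.\<close>

definition alive :: "real^7 \<Rightarrow> real \<Rightarrow> nat \<Rightarrow> bool" where
  "alive z s v \<longleftrightarrow> (\<forall>w. linked z s v w \<longrightarrow> \<not> older z w v)"

definition death :: "real^7 \<Rightarrow> nat \<Rightarrow> ereal" where
  "death z v = (let K = {i \<in> T_vertices. \<not> alive z (zv z i) v} in
     if K = {} then \<infinity> else ereal (Min (zv z ` K)))"

lemma alive_antimono: "alive z t v \<Longrightarrow> s \<le> t \<Longrightarrow> alive z s v"
  by (auto simp: alive_def dest: linked_mono)

text \<open>Sublevel sets change only at vertex values. A vertex that is dead at \<open>s\<close> is
  therefore already dead at the largest vertex value not exceeding \<open>s\<close>, and the minimum
  in \<open>death\<close> is the exact time of the change.\<close>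

lemma alive_iff_less_death: "alive z s v \<longleftrightarrow> ereal s < death z v"
proof -
  define K where "K = {i \<in> T_vertices. \<not> alive z (zv z i) v}"
  have "finite K" by (simp add: K_def finite_T_vertices)
  have "\<exists>i\<in>K. zv z i \<le> s" if dead: "\<not> alive z s v"
  proof -
    obtain w where w: "linked z s v w" "older z w v" using dead by (auto simp: alive_def)
    hence "v \<noteq> w" by (auto simp: older_def)
    define L where "L = {i \<in> T_vertices. zv z i \<le> s}"
    have "v \<in> T_vertices" using w(1) \<open>v \<noteq> w\<close>
      by (auto elim: converse_rtranclpE dest: sub_adj_in_vertices)
    hence "v \<in> L" using linked_le[OF w(1) \<open>v \<noteq> w\<close>] by (simp add: L_def)
    have "finite L" by (simp add: L_def finite_T_vertices)
    have "Max (zv z ` L) \<in> zv z ` L" using \<open>finite L\<close> \<open>v \<in> L\<close> by (intro Max_in) auto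
    then obtain i where i: "i \<in> L" "Max (zv z ` L) = zv z i" by auto
    have "sub_adj z s x y \<Longrightarrow> sub_adj z (zv z i) x y" for x y
    proof -
      assume a: "sub_adj z s x y"
      hence "x \<in> L" "y \<in> L" using sub_adj_in_vertices[OF a] by (auto simp: L_def sub_adj_def)
      hence "zv z x \<le> zv z i" "zv z y \<le> zv z i" using \<open>finite L\<close> i(2) by (metis Max_ge finite_imageI imageI)+
      with a show ?thesis by (auto simp: sub_adj_def)
    qed
    hence "linked z (zv z i) v w" using w(1) by (metis mono_rtranclp)
    hence "i \<in> K" using w(2) i(1) by (auto simp: K_def L_def alive_def)
    with i(1) show ?thesis by (auto simp: L_def)
  qed
  moreover have "\<not> alive z s v" if "i \<in> K" "zv z i \<le> s" for i
    using that alive_antimono by (auto simp: K_def)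
  ultimately have "alive z s v \<longleftrightarrow> (\<forall>i\<in>K. s < zv z i)" by (meson not_le)
  also have "\<dots> \<longleftrightarrow> ereal s < death z v"
    using \<open>finite K\<close> by (auto simp: death_def Let_def K_def[symmetric])
  finally show ?thesis .
qed

lemma oldest_linked:
  assumes "v \<in> T_vertices"
  obtains w where "w \<in> T_vertices" "linked z s v w" "alive z s w" "zv z w \<le> zv z v"
proof -
  define C where "C = {w. linked z s v w}"
  have CV: "C \<subseteq> T_vertices" using assms linked_in_vertices by (auto simp: C_def)
  have "finite C" using CV finite_T_vertices finite_subset by blast
  have "v \<in> C" by (simp add: C_def)
  define m where "m = Min (zv z ` C)"
  have m_le: "m \<le> zv z i" if "i \<in> C" for i using that \<open>finite C\<close> by (simp add: m_def)
  have "m \<in> zv z ` C" unfolding m_def using \<open>finite C\<close> \<open>v \<in> C\<close> by (intro Min_in) auto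
  define W where "W = {i \<in> C. zv z i = m}"
  have "W \<noteq> {}" "finite W" using \<open>m \<in> _\<close> \<open>finite C\<close> by (auto simp: W_def)
  define w where "w = Min W"
  have "w \<in> W" unfolding w_def using \<open>finite W\<close> \<open>W \<noteq> {}\<close> by (rule Min_in)
  hence w: "w \<in> C" "zv z w = m" by (auto simp: W_def)
  have "alive z s w"
    unfolding alive_def
  proof (intro allI impI notI)
    fix x assume x: "linked z s w x" "older z x w"
    hence "x \<in> C" using w(1) by (auto simp: C_def)
    with m_le[OF this] x(2) w have "x \<in> W" "x < w" by (auto simp: older_def W_def)
    with Min_le[OF \<open>finite W\<close> \<open>x \<in> W\<close>] show False by (simp add: w_def)
  qed
  with that w CV m_le[OF \<open>v \<in> C\<close>] show thesis by (auto simp: C_def)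
qed

text \<open>Every component has one oldest vertex, and this vertex lies in \<open>T_r\<close>
  whenever the component meets \<open>T_r\<close>. Counting vertices born by \<open>r\<close> and
  alive at \<open>s\<close> thus counts the components in the definition of \<open>rank0\<close>.
  This supplies the existence half for the definite description in \<open>PH0\<close>.\<close>

lemma elder_rule_diagram:
  obtains D where "off_diagonal D" "\<And>r s. r \<le> s \<Longrightarrow> rank_invariant D r s = rank0 z r s"
proof
  \<comment> \<open>Vertices that die at their own value would give points on the diagonal.\<close>
  define X where "X = {v \<in> T_vertices. ereal (zv z v) < death z v}"
  define D where "D = image_mset (\<lambda>v. (zv z v, death z v)) (mset_set X)"
  have "finite X" by (simp add: X_def finite_T_vertices)
  show "off_diagonal D" using \<open>finite X\<close> by (auto simp: off_diagonal_def D_def X_def)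
  fix r s :: real
  assume "r \<le> s"
  define Y where "Y = {v \<in> T_vertices. zv z v \<le> r \<and> alive z s v}"
  have "rank_invariant D r s = card {v \<in> X. zv z v \<le> r \<and> ereal s < death z v}"
    using \<open>finite X\<close> by (simp add: rank_invariant_def D_def filter_mset_image_mset filter_mset_mset_set)
  also have "{v \<in> X. zv z v \<le> r \<and> ereal s < death z v} = Y"
    using \<open>r \<le> s\<close> by (auto simp: X_def Y_def alive_iff_less_death[symmetric] intro: alive_antimono)
  also have "card Y = card (sub_comp z s ` Y)"
  proof (intro card_image[symmetric] inj_onI)
    fix v w assume vw: "v \<in> Y" "w \<in> Y" "sub_comp z s v = sub_comp z s w"
    hence "linked z s v w" "linked z s w v" by (auto simp only: sub_comp_eq_iff dest: linked_sym)
    hence "\<not> older z w v" "\<not> older z v w" using vw(1,2) by (auto simp: Y_def alive_def)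
    thus "v = w" by (auto simp: older_def not_less)
  qed
  also have "sub_comp z s ` Y = sub_comp z s ` {v \<in> T_vertices. zv z v \<le> r}"
  proof (intro equalityI subsetI)
    fix C assume "C \<in> sub_comp z s ` {v \<in> T_vertices. zv z v \<le> r}"
    then obtain v where v: "v \<in> T_vertices" "zv z v \<le> r" "C = sub_comp z s v" by auto
    obtain w where "w \<in> T_vertices" "linked z s v w" "alive z s w" "zv z w \<le> zv z v"
      using oldest_linked[OF v(1)] by blast
    hence "w \<in> Y" "C = sub_comp z s w" using v by (auto simp: Y_def sub_comp_eq_iff)
    thus "C \<in> sub_comp z s ` Y" by blast
  qed (auto simp: Y_def)
  finally show "rank_invariant D r s = rank0 z r s" by (simp add: rank0_def)
qed

text \<open>The elder rule gives existence and \<open>rank_invariant_inj\<close> uniqueness, so the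
  definite description may be replaced by its defining property.\<close>

lemma PH0_eq_iff:
  assumes "off_diagonal D"
  shows "PH0 z = D \<longleftrightarrow> (\<forall>r s. r \<le> s \<longrightarrow> rank_invariant D r s = rank0 z r s)"
proof -
  define good where "good D \<longleftrightarrow> off_diagonal D \<and> (\<forall>r s. r \<le> s \<longrightarrow> rank_invariant D r s = rank0 z r s)" for D
  have PH0: "PH0 z = (THE D. good D)"
    by (simp add: PH0_def good_def off_diagonal_def rank_invariant_def)
  have "\<exists>!D. good D"
  proof (rule ex_ex1I)
    show "\<exists>D. good D" using elder_rule_diagram[of z] unfolding good_def by metis
    show "D = D'" if "good D" "good D'" for D D'
      using that by (intro rank_invariant_inj) (auto simp: good_def)
  qed
  hence "PH0 z = D \<longleftrightarrow> good D" unfolding PH0 by (metis theI' the1_equality)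
  thus ?thesis using assms by (simp add: good_def)
qed

section \<open>The prescribed diagram and functions with two valleys\<close>

lemma data_P_iff_rank0:
  "z \<in> data_P \<longleftrightarrow>
     (\<forall>r s. r \<le> s \<longrightarrow> rank0 z r s = (if 0 \<le> r then 1 else 0) + (if 1 \<le> r \<and> s < 4 then 1 else 0))"
proof -
  have "off_diagonal P_diag" by (auto simp: off_diagonal_def P_diag_def)
  moreover have "rank_invariant P_diag r s =
      (if 0 \<le> r then 1 else 0) + (if 1 \<le> r \<and> s < 4 then 1 else 0)" for r s
    by (simp add: rank_invariant_def P_diag_def)
  ultimately show ?thesis unfolding data_P_def mem_Collect_eq
    by (subst PH0_eq_iff) (auto simp only: eq_commute)
qed

text \<open>\<open>p\<close> and \<open>q\<close> are the bottoms. The clause on all vertices says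
  that each vertex, at its own level, already belongs to the component of a bottom, so no third
  component is ever born.\<close>

definition two_valleys :: "real^7 \<Rightarrow> nat \<Rightarrow> nat \<Rightarrow> bool" where
  "two_valleys z p q \<longleftrightarrow> p \<in> T_vertices \<and> q \<in> T_vertices \<and> zv z p = 0 \<and> zv z q = 1 \<and>
     (\<forall>v\<in>T_vertices. 0 \<le> zv z v \<and>
        (linked z (zv z v) v p \<or> (1 \<le> zv z v \<and> linked z (zv z v) v q))) \<and>
     linked z 4 p q \<and> (\<forall>s<4. \<not> linked z s p q)"

text \<open>Components of \<open>T_s\<close> meeting \<open>T_r\<close> are represented by bottoms:
  by none for \<open>r < 0\<close>, by both if \<open>1 \<le> r\<close> and \<open>s < 4\<close>,
  and by \<open>p\<close> alone otherwise, since then either \<open>q\<close> is not yet born or it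
  has merged with \<open>p\<close>.\<close>

lemma two_valleys_imp_data_P:
  assumes "two_valleys z p q"
  shows "z \<in> data_P"
  unfolding data_P_iff_rank0
proof (intro allI impI)
  fix r s :: real assume "r \<le> s"
  note pq = assms[unfolded two_valleys_def]
  define I where "I = sub_comp z s ` {v \<in> T_vertices. zv z v \<le> r}"
  have lnk: "linked z s v p \<or> (1 \<le> zv z v \<and> linked z s v q)" if "v \<in> T_vertices" "zv z v \<le> r" for v
    using pq that \<open>r \<le> s\<close> linked_mono by (metis order_trans)
  consider "r < 0" | "0 \<le> r" "r < 1 \<or> 4 \<le> s" | "1 \<le> r" "s < 4" by linarith
  hence "card I = (if 0 \<le> r then 1 else 0) + (if 1 \<le> r \<and> s < 4 then 1 else 0)"
  proof cases
    case 1
    hence "I = {}" using pq by (fastforce simp: I_def)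
    thus ?thesis using 1 by simp
  next
    case 2
    have "linked z s v p" if "v \<in> T_vertices" "zv z v \<le> r" for v
    proof (cases "r < 1")
      case True thus ?thesis using lnk[OF that] that by linarith
    next
      case False
      hence "linked z s p q" using 2 pq linked_mono by blast
      thus ?thesis using lnk[OF that] by (meson linked_sym rtranclp_trans)
    qed
    have "C = sub_comp z s p" if "C \<in> I" for C
    proof -
      obtain v where "v \<in> T_vertices" "zv z v \<le> r" "C = sub_comp z s v"
        using \<open>C \<in> I\<close> by (auto simp only: I_def)
      thus ?thesis using \<open>\<And>v. v \<in> T_vertices \<Longrightarrow> zv z v \<le> r \<Longrightarrow> linked z s v p\<close>
        by (simp only: sub_comp_eq_iff)
    qed
    moreover have "sub_comp z s p \<in> I" using pq 2(1) by (simp add: I_def)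
    ultimately have "I = {sub_comp z s p}" by blast
    thus ?thesis using 2 by auto
  next
    case 3
    have "C = sub_comp z s p \<or> C = sub_comp z s q" if "C \<in> I" for C
    proof -
      obtain v where v: "v \<in> T_vertices" "zv z v \<le> r" "C = sub_comp z s v"
        using \<open>C \<in> I\<close> by (auto simp only: I_def)
      show ?thesis using lnk[OF v(1,2)] by (auto simp only: v(3) sub_comp_eq_iff)
    qed
    moreover have "sub_comp z s p \<in> I" "sub_comp z s q \<in> I" using pq 3 by (simp_all add: I_def)
    ultimately have "I = {sub_comp z s p, sub_comp z s q}" by blast
    moreover have "sub_comp z s p \<noteq> sub_comp z s q" using pq 3 by (simp add: sub_comp_eq_iff)
    ultimately show ?thesis using 3 by simp
  qed
  thus "rank0 z r s = (if 0 \<le> r then 1 else 0) + (if 1 \<le> r \<and> s < 4 then 1 else 0)"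
    by (simp add: rank0_def I_def)
qed

text \<open>Rank one at \<open>(0, 0)\<close> yields \<open>p\<close>. Rank two at
  \<open>(1, t)\<close>, with \<open>t\<close> the last level before the merge, yields a vertex
  \<open>q\<close> of another component.\<close>

lemma data_P_imp_two_valleys:
  assumes "z \<in> data_P"
  obtains p q where "two_valleys z p q"
proof -
  note rk = assms[unfolded data_P_iff_rank0, rule_format]
  define I where "I r s = sub_comp z s ` {v \<in> T_vertices. zv z v \<le> r}" for r s
  have finI: "finite (I r s)" for r s by (simp add: I_def finite_T_vertices)
  have cI: "card (I r s) = (if 0 \<le> r then 1 else 0) + (if 1 \<le> r \<and> s < 4 then 1 else 0)"
    if "r \<le> s" for r s using rk[OF that] by (simp add: rank0_def I_def)
  have mem: "sub_comp z s v \<in> I r s" if "v \<in> T_vertices" "zv z v \<le> r" for v r s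
    using that by (auto simp: I_def)
  have nonneg: "0 \<le> zv z v" if "v \<in> T_vertices" for v
  proof (rule ccontr)
    assume "\<not> 0 \<le> zv z v"
    hence "card (I (zv z v) (zv z v)) = 0" using cI[of "zv z v" "zv z v"] by simp
    thus False using mem[OF that] finI by fastforce
  qed
  have one: "linked z s u v" if "card (I r s) = 1" "u \<in> T_vertices" "v \<in> T_vertices"
    "zv z u \<le> r" "zv z v \<le> r" for u v r s
    using that mem[of u r s] mem[of v r s] by (metis card_1_singletonE singletonD sub_comp_eq_iff)
  have "card (I 0 0) = 1" using cI[of 0 0] by simp
  hence "I 0 0 \<noteq> {}" by force
  then obtain p where p: "p \<in> T_vertices" "zv z p \<le> 0"
    by (auto simp: I_def)
  hence zp: "zv z p = 0" using nonneg[of p] by simp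
  \<comment> \<open>The largest vertex value below 4, or 1 if that is greater. Every
    \<open>T_s\<close> with \<open>s < 4\<close> has its edges in \<open>T_t\<close>, so separation
    at \<open>t\<close> gives separation at all levels below 4.\<close>
  define t where "t = Max (insert 1 {zv z v |v. v \<in> T_vertices \<and> zv z v < 4})"
  have fin: "finite {zv z v |v. v \<in> T_vertices \<and> zv z v < 4}" using finite_T_vertices by simp
  have "t \<in> insert 1 {zv z v |v. v \<in> T_vertices \<and> zv z v < 4}"
    unfolding t_def using fin by (intro Max_in) auto
  hence "t < 4" by auto
  have "1 \<le> t" unfolding t_def using fin by auto
  have t_ge: "zv z v \<le> t" if "v \<in> T_vertices" "zv z v < 4" for v
    unfolding t_def using fin that by (intro Max_ge) auto
  have "card (I 1 t) = 2" using cI[OF \<open>1 \<le> t\<close>] \<open>t < 4\<close> by simp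
  hence "\<not> I 1 t \<subseteq> {sub_comp z t p}" by (metis card_mono card.empty card_insert_disjoint
        finite.emptyI finite_insert empty_iff One_nat_def Suc_1 Suc_n_not_le_n)
  then obtain q where q: "q \<in> T_vertices" "zv z q \<le> 1" "sub_comp z t q \<noteq> sub_comp z t p"
    unfolding I_def by blast
  hence q_unlinked: "\<not> linked z t p q" by (metis sub_comp_eq_iff)
  have "zv z q = 1"
  proof (rule ccontr)
    assume "zv z q \<noteq> 1"
    hence "zv z q < 1" using q by simp
    hence "card (I (zv z q) t) = 1" using cI[of "zv z q" t] nonneg[OF q(1)] \<open>1 \<le> t\<close> by simp
    from one[OF this p(1) q(1)] nonneg[OF q(1)] zp q_unlinked show False by simp
  qed
  have nl: "\<not> linked z s p q" if "s < 4" for s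
  proof
    assume l: "linked z s p q"
    have "sub_adj z s x y \<Longrightarrow> sub_adj z t x y" for x y
    proof -
      assume a: "sub_adj z s x y"
      hence "zv z x < 4" "zv z y < 4" using that by (auto simp: sub_adj_def)
      hence "zv z x \<le> t" "zv z y \<le> t" using t_ge sub_adj_in_vertices[OF a] by auto
      with a show ?thesis by (auto simp: sub_adj_def)
    qed
    hence "linked z t p q" using l by (metis mono_rtranclp)
    with q_unlinked show False by simp
  qed
  have "linked z 4 p q" using one[of 4 4 p q] cI[of 4 4] p q by simp
  moreover have "linked z (zv z v) v p \<or> (1 \<le> zv z v \<and> linked z (zv z v) v q)"
    if v: "v \<in> T_vertices" for v
  proof (cases "1 \<le> zv z v \<and> zv z v < 4")
    case False
    hence "card (I (zv z v) (zv z v)) = 1" using cI[of "zv z v" "zv z v"] nonneg[OF v] by auto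
    from one[OF this v p(1)] nonneg[OF v] zp show ?thesis by simp
  next
    case True
    let ?s = "zv z v"
    \<comment> \<open>Three vertices share two components, and \<open>p\<close> and \<open>q\<close>
      are still apart, so \<open>v\<close> joins one of them.\<close>
    have "card (I ?s ?s) = 2" using cI[of ?s ?s] True by simp
    moreover have "{sub_comp z ?s p, sub_comp z ?s q, sub_comp z ?s v} \<subseteq> I ?s ?s"
      using mem p q v zp \<open>zv z q = 1\<close> True nonneg by auto
    ultimately have "card {sub_comp z ?s p, sub_comp z ?s q, sub_comp z ?s v} \<le> 2"
      using card_mono[OF finI] by metis
    moreover have "sub_comp z ?s p \<noteq> sub_comp z ?s q" using nl True by (simp add: sub_comp_eq_iff)
    ultimately have "sub_comp z ?s v = sub_comp z ?s p \<or> sub_comp z ?s v = sub_comp z ?s q"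
      by (auto simp: card_insert_if split: if_splits)
    thus ?thesis using True by (auto simp: sub_comp_eq_iff)
  qed
  ultimately have "two_valleys z p q"
    using p q zp \<open>zv z q = 1\<close> nl nonneg by (auto simp: two_valleys_def)
  thus thesis by (rule that)
qed

section \<open>Valleys on the tripod\<close>

text \<open>The tree is a tripod with centre 3; \<open>l\<close> is a leaf and \<open>a\<close> the
  inner vertex between it and the centre.\<close>

definition arm :: "nat \<Rightarrow> nat \<Rightarrow> bool" where
  "arm l a \<longleftrightarrow> (l, a) \<in> {(1, 2), (5, 4), (7, 6)}"

definition arms :: "nat \<Rightarrow> nat \<Rightarrow> nat \<Rightarrow> nat \<Rightarrow> nat \<Rightarrow> nat \<Rightarrow> bool" where
  "arms li ai lj aj lk ak \<longleftrightarrow> arm li ai \<and> arm lj aj \<and> arm lk ak \<and> distinct [li, lj, lk]"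

lemma arms_swap_ij: "arms li ai lj aj lk ak \<Longrightarrow> arms lj aj li ai lk ak"
  by (auto simp: arms_def)

lemma ex_arms1:
  assumes "arm l a"
  shows "\<exists>lj aj lk ak. arms l a lj aj lk ak"
proof -
  have "arms 1 2 5 4 7 6" "arms 5 4 1 2 7 6" "arms 7 6 1 2 5 4" by (simp_all add: arms_def arm_def)
  moreover have "l = 1 \<and> a = 2 \<or> l = 5 \<and> a = 4 \<or> l = 7 \<and> a = 6" using assms by (simp add: arm_def)
  ultimately show ?thesis by blast
qed

lemma ex_arms2: "arm l a \<Longrightarrow> arm l' a' \<Longrightarrow> l \<noteq> l' \<Longrightarrow> \<exists>lk ak. arms l a l' a' lk ak"
  by (auto simp: arms_def arm_def)

lemma vertex_cases:
  assumes "v \<in> T_vertices"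
  obtains "v = 3" | l a where "arm l a" "v \<in> {l, a}"
proof -
  have "v \<in> {1,2,3,4,5,6,7}" using assms by (auto simp: T_vertices_def)
  thus thesis using that by (auto simp: arm_def)
qed

lemma arms_vertices:
  assumes "arms li ai lj aj lk ak"
  shows "T_vertices = {3, li, ai, lj, aj, lk, ak}" and "distinct [3, li, ai, lj, aj, lk, ak]"
proof -
  have "T_vertices = {1,2,3,4,5,6,7}" by (auto simp: T_vertices_def)
  thus "T_vertices = {3, li, ai, lj, aj, lk, ak}" using assms by (auto simp: arms_def arm_def)
  show "distinct [3, li, ai, lj, aj, lk, ak]" using assms by (auto simp: arms_def arm_def)
qed

lemma linked_leaf: "arm l a \<Longrightarrow> zv z l \<le> s \<Longrightarrow> zv z a \<le> s \<Longrightarrow> linked z s l a"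
  by (rule r_into_rtranclp) (auto simp: arm_def sub_adj_def T_edges_def)

lemma linked_center: "arm l a \<Longrightarrow> zv z a \<le> s \<Longrightarrow> zv z 3 \<le> s \<Longrightarrow> linked z s a 3"
  by (rule r_into_rtranclp) (auto simp: arm_def sub_adj_def T_edges_def)

lemma linked_to_center:
  assumes "arm l a" "x \<in> {l, a}" "zv z x \<le> s" "zv z a \<le> s" "zv z 3 \<le> s"
  shows "linked z s x 3"
  using assms linked_leaf[of l a z s] linked_center[of l a z s] by (auto intro: rtranclp_trans)

lemma leaf_cut:
  assumes "arm l a" "linked z s l x" "x \<noteq> l"
  shows "zv z l \<le> s \<and> zv z a \<le> s"
  using assms(2)
proof (cases rule: converse_rtranclpE)
  case (step y)
  hence "y = a" using assms(1) by (auto simp: arm_def sub_adj_def T_edges_def)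
  thus ?thesis using step by (auto simp: sub_adj_def)
qed (use assms in auto)

text \<open>The edge from \<open>a\<close> to the centre is the only one leaving the arm, so a path
  out of the arm needs it at level \<open>s\<close>.\<close>

lemma arm_cut:
  assumes "arm l a" "linked z s u v" "u \<in> {l, a}" "v \<notin> {l, a}"
  shows "zv z a \<le> s \<and> zv z 3 \<le> s"
proof -
  have "v \<in> {l, a} \<or> (zv z a \<le> s \<and> zv z 3 \<le> s)"
    using assms(2)
  proof (induction rule: rtranclp_induct)
    case (step v w)
    thus ?case using assms(1) by (auto simp: arm_def sub_adj_def T_edges_def)
  qed (use assms in auto)
  thus ?thesis using assms(4) by blast
qed

text \<open>The arms \<open>i\<close>, \<open>j\<close>, \<open>k\<close> join leaf values \<open>l\<close> through inner values \<open>a\<close> to the centre value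
  \<open>c\<close>. The valley of depth \<open>0\<close> lies on arm \<open>i\<close> and that of depth \<open>1\<close> on arm \<open>j\<close>, up to extending
  over the centre; the three disjuncts say that the separating value \<open>4\<close> is attained at the
  centre, on arm \<open>j\<close>, or on arm \<open>i\<close>.\<close>
definition config :: "real \<Rightarrow> real \<Rightarrow> real \<Rightarrow> real \<Rightarrow> real \<Rightarrow> real \<Rightarrow> real \<Rightarrow> bool" where
  "config c li ai lj aj lk ak \<longleftrightarrow> c \<le> 4 \<and> c \<le> ak \<and> ak \<le> lk \<and>
     (c = 4 \<and> min ai li = 0 \<and> ai \<le> 4 \<and> min aj lj = 1 \<and> aj \<le> 4 \<or>
      lj = 1 \<and> aj = 4 \<and> min c (min ai li) = 0 \<and> ai \<le> max c li \<or>
      li = 0 \<and> ai = 4 \<and> min c (min aj lj) = 1 \<and> aj \<le> max c lj)"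

text \<open>This treats bottoms on two different arms. One of the two inner vertices and the centre
  between them has value 4, and each possibility leads to one disjunct of
  \<open>config\<close>.\<close>

lemma config_of_peak:
  assumes "c \<le> 4" "ai \<le> 4" "aj \<le> 4" "c \<le> ak" "ak \<le> lk" "ai = 4 \<or> c = 4 \<or> aj = 4"
    and c: "ai \<le> c \<or> (1 \<le> c \<and> aj \<le> c)" and j: "1 \<le> lj \<or> c \<le> lj" "1 \<le> aj \<or> c \<le> aj"
    and i: "0 \<le> ai" "0 \<le> li" "0 \<le> c" "ai = 0 \<or> li = 0" "aj = 1 \<or> lj = 1"
  shows "config c li ai lj aj lk ak"
proof -
  consider "c = 4" | "c < 4" "aj = 4" | "c < 4" "ai = 4" using assms(1,6) by linarith
  thus ?thesis
  proof cases
    case 1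
    hence "min ai li = 0" "min aj lj = 1" using i j by (auto simp: min_def)
    thus ?thesis using 1 assms(2-5) by (simp add: config_def)
  next
    case 2
    hence "ai \<le> c" "lj = 1" "min c (min ai li) = 0" using i c by (auto simp: min_def)
    thus ?thesis using 2 assms(4,5) by (simp add: config_def)
  next
    case 3
    hence "aj \<le> c" "li = 0" "min c (min aj lj) = 1" using i c j by (auto simp: min_def)
    thus ?thesis using 3 assms(4,5) by (simp add: config_def)
  qed
qed

text \<open>The bottoms lie on distinct arms, or one of them is the centre. The cut lemmas turn the
  linkage of each vertex to a bottom into inequalities along the arms.\<close>

lemma two_valleys_imp_config:
  assumes tv: "two_valleys z p q"
  shows "\<exists>li ai lj aj lk ak. arms li ai lj aj lk ak \<and>
     config (zv z 3) (zv z li) (zv z ai) (zv z lj) (zv z aj) (zv z lk) (zv z ak)"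
proof -
  note pq = tv[unfolded two_valleys_def]
  have zp: "zv z p = 0" and zq: "zv z q = 1" and l4: "linked z 4 p q" using pq by auto
  have nl: "4 \<le> s" if "linked z s p q" for s using pq that by (meson not_le)
  have nonneg: "0 \<le> zv z v" if "v \<in> T_vertices" for v using pq that by blast
  have lnk: "linked z (zv z v) v p \<or> (1 \<le> zv z v \<and> linked z (zv z v) v q)" if "v \<in> T_vertices" for v
    using pq that by blast
  have "p \<noteq> q" using zp zq by auto
  have arm_in: "l \<in> T_vertices" "a \<in> T_vertices" "l \<noteq> a" "l \<noteq> 3" "a \<noteq> 3" if "arm l a" for l a
    using that by (auto simp: arm_def T_vertices_def)
  have V3: "3 \<in> T_vertices" by (simp add: T_vertices_def)
  have leaf: "zv z a \<le> zv z l" if "arm l a" "l \<noteq> p" "l \<noteq> q" for l a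
    using lnk[of l] arm_in[OF that(1)] leaf_cut[OF that(1)] that by blast
  have side: "zv z 3 \<le> zv z a" if "arm l a" "p \<notin> {l, a}" "q \<notin> {l, a}" for l a
    using lnk[of a] arm_in[OF that(1)] arm_cut[OF that(1), of z "zv z a" a] that by blast
  \<comment> \<open>Bottoms on one arm are adjacent and would merge at level 1.\<close>
  have not_same: False if "arm l a" "p \<in> {l, a}" "q \<in> {l, a}" for l a
  proof -
    have "linked z 1 l a" using that zp zq \<open>p \<noteq> q\<close> by (intro linked_leaf) auto
    hence "linked z 1 p q" using that linked_sym by auto
    thus False using nl by force
  qed
  have "p \<in> T_vertices" "q \<in> T_vertices" using pq by auto
  note to3 = linked_to_center[of _ _ _ z]
  show ?thesis
    using \<open>p \<in> T_vertices\<close>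
  proof (cases p rule: vertex_cases)
    case 1
    note p3 = this
    show ?thesis
      using \<open>q \<in> T_vertices\<close>
    proof (cases q rule: vertex_cases)
      case 1
      thus ?thesis using p3 \<open>p \<noteq> q\<close> by simp
    next
      case (2 lj aj)
      obtain li ai lk ak where "arms lj aj li ai lk ak" using ex_arms1[OF 2(1)] by blast
      hence arms: "arms li ai lj aj lk ak" by (rule arms_swap_ij)
      hence A: "arm li ai" "arm lj aj" "arm lk ak" by (auto simp: arms_def)
      note d = arms_vertices(2)[OF arms]
      have V: "{li, ai, lj, aj, lk, ak} \<subseteq> T_vertices" using arms_vertices(1)[OF arms] by auto
      have aj: "zv z aj \<le> 4" using arm_cut[OF 2(1) linked_sym[OF l4] 2(2)] p3 d by auto
      \<comment> \<open>All values on the path from \<open>q\<close> to the centre are at most this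
        maximum, so the merge at level 4 bounds it from below.\<close>
      have "4 \<le> max 1 (zv z aj)"
        using to3[OF 2, of "max 1 (zv z aj)"] zp zq p3 linked_sym by (intro nl) auto
      hence aj4: "zv z aj = 4" using aj by linarith
      hence "q = lj" using 2 zq by auto
      have "zv z ai \<le> zv z li" "zv z ak \<le> zv z lk"
        using leaf[OF A(1)] leaf[OF A(3)] p3 \<open>q = lj\<close> d by auto
      moreover have "zv z 3 \<le> zv z ak" using side[OF A(3)] p3 \<open>q = lj\<close> d by auto
      moreover have "0 \<le> zv z ai" "0 \<le> zv z li" using nonneg V by auto
      ultimately have "config (zv z 3) (zv z li) (zv z ai) (zv z lj) (zv z aj) (zv z lk) (zv z ak)"
        using zp zq p3 \<open>q = lj\<close> aj4 by (auto simp: config_def)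
      thus ?thesis using arms by blast
    qed
  next
    case (2 li ai)
    note p = this
    show ?thesis
      using \<open>q \<in> T_vertices\<close>
    proof (cases q rule: vertex_cases)
      case 1
      obtain lj aj lk ak where arms: "arms li ai lj aj lk ak" using ex_arms1[OF p(1)] by blast
      hence A: "arm li ai" "arm lj aj" "arm lk ak" by (auto simp: arms_def)
      note d = arms_vertices(2)[OF arms]
      have ai: "zv z ai \<le> 4" using arm_cut[OF p(1) l4 p(2)] 1 d by auto
      have "4 \<le> max 1 (zv z ai)"
        using to3[OF p, of "max 1 (zv z ai)"] zp zq 1 by (intro nl) auto
      hence ai4: "zv z ai = 4" using ai by linarith
      hence "p = li" using p zp by auto
      have "zv z aj \<le> zv z lj" "zv z ak \<le> zv z lk"
        using leaf[OF A(2)] leaf[OF A(3)] 1 \<open>p = li\<close> d by auto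
      moreover have "zv z 3 \<le> zv z ak" "zv z 3 \<le> zv z aj"
        using side[OF A(3)] side[OF A(2)] 1 \<open>p = li\<close> d by auto
      ultimately have "config (zv z 3) (zv z li) (zv z ai) (zv z lj) (zv z aj) (zv z lk) (zv z ak)"
        using zp zq 1 \<open>p = li\<close> ai4 by (auto simp: config_def)
      thus ?thesis using arms by blast
    next
      case (2 lj aj)
      note q = this
      have "li \<noteq> lj" using not_same[OF p] q p by (auto simp: arm_def)
      then obtain lk ak where arms: "arms li ai lj aj lk ak" using ex_arms2[OF p(1) q(1)] by blast
      hence A: "arm li ai" "arm lj aj" "arm lk ak" by (auto simp: arms_def)
      note d = arms_vertices(2)[OF arms]
      have V: "{li, ai, lj, aj, lk, ak} \<subseteq> T_vertices" using arms_vertices(1)[OF arms] by auto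
      have c: "zv z ai \<le> 4" "zv z 3 \<le> 4" "zv z aj \<le> 4"
        using arm_cut[OF p(1) l4 p(2)] arm_cut[OF q(1) linked_sym[OF l4] q(2)] p q d by auto
      have k: "zv z 3 \<le> zv z ak" "zv z ak \<le> zv z lk"
        using side[OF A(3)] leaf[OF A(3)] p q d by auto
      \<comment> \<open>The path between the bottoms stays at or below \<open>m\<close>, hence
        \<open>m\<close> is at least the merge level 4.\<close>
      define m where "m = Max {1, zv z ai, zv z 3, zv z aj}"
      have "1 \<le> m" "zv z ai \<le> m" "zv z 3 \<le> m" "zv z aj \<le> m" by (auto simp: m_def)
      hence "linked z m p q"
        using to3[OF p, of m] to3[OF q, of m] zp zq by (auto intro: rtranclp_trans linked_sym)
      hence "4 \<le> m" by (rule nl)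
      hence peak: "zv z ai = 4 \<or> zv z 3 = 4 \<or> zv z aj = 4" using c by (auto simp: m_def)
      have c3: "zv z ai \<le> zv z 3 \<or> (1 \<le> zv z 3 \<and> zv z aj \<le> zv z 3)"
        using lnk[OF V3] linked_sym[of z "zv z 3" 3] arm_cut[OF p(1) _ p(2), of z "zv z 3" 3]
          arm_cut[OF q(1) _ q(2), of z "zv z 3" 3] d by auto
      have j: "1 \<le> zv z v \<or> zv z 3 \<le> zv z v" if "v \<in> {lj, aj}" for v
        using lnk[of v] V that arm_cut[OF q(1) _ that, of z "zv z v" p] p d by auto
      have "0 \<le> zv z ai" "0 \<le> zv z li" "0 \<le> zv z 3" using nonneg V V3 by auto
      moreover have "zv z ai = 0 \<or> zv z li = 0" "zv z aj = 1 \<or> zv z lj = 1" using p q zp zq by auto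
      ultimately have "config (zv z 3) (zv z li) (zv z ai) (zv z lj) (zv z aj) (zv z lk) (zv z ak)"
        using c k peak c3 j[of lj] j[of aj]
        by (intro config_of_peak) auto
      thus ?thesis using arms by blast
    qed
  qed
qed

lemma linked_within_arm:
  assumes "arm l a" "x \<in> {l, a}" "y \<in> {l, a}" "zv z x \<le> s" "zv z y \<le> s"
  shows "linked z s x y"
  using assms linked_leaf[of l a z s] linked_sym by auto

text \<open>The bound on the inner value forbids a strict interior peak on the path
  \<open>3\<close>, \<open>a\<close>, \<open>l\<close>. Its sublevel sets are then connected, and
  each of its vertices reaches a minimum at its own level.\<close>

lemma valley_over_center:
  assumes "arm l a" "min (zv z 3) (min (zv z a) (zv z l)) = m" "zv z a \<le> max (zv z 3) (zv z l)"
  obtains r where "r \<in> {3, l, a}" "zv z r = m"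
    "\<And>v. v \<in> {3, l, a} \<Longrightarrow> m \<le> zv z v \<and> linked z (zv z v) v r"
proof (cases "zv z 3 = m")
  case True
  have "m \<le> zv z v \<and> linked z (zv z v) v 3" if "v \<in> {3, l, a}" for v
    using that assms True linked_to_center[OF assms(1), of v z "zv z v"] by auto
  thus thesis using that True by blast
next
  case False
  then obtain r where r: "r \<in> {l, a}" "zv z r = m"
    using assms(2) by (auto simp: min_def split: if_splits)
  have "m \<le> zv z v \<and> linked z (zv z v) v r" if "v \<in> {3, l, a}" for v
  proof (cases "v = 3")
    case True
    have "zv z a \<le> zv z 3" "m \<le> zv z 3" using r assms(2,3) by auto
    thus ?thesis using True r linked_to_center[OF assms(1) r(1), of z "zv z 3"] linked_sym by auto
  next
    case False
    thus ?thesis using that r assms(2) linked_within_arm[OF assms(1) _ r(1), of v z "zv z v"] by auto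
  qed
  thus thesis using that r by blast
qed

text \<open>The barrier of height 4 is the centre, \<open>aj\<close> or \<open>ai\<close>, according
  to the disjunct, and \<open>arm_cut\<close> there keeps the bottoms apart below 4. Values on arm
  \<open>k\<close> do not decrease away from the centre, so its vertices reach the centre at their
  own level.\<close>

lemma config_imp_two_valleys:
  assumes arms: "arms li ai lj aj lk ak"
    and cfg: "config (zv z 3) (zv z li) (zv z ai) (zv z lj) (zv z aj) (zv z lk) (zv z ak)"
  shows "\<exists>p q. two_valleys z p q"
proof -
  have A: "arm li ai" "arm lj aj" "arm lk ak" using arms by (auto simp: arms_def)
  note d = arms_vertices(2)[OF arms] and V = arms_vertices(1)[OF arms]
  have k: "zv z 3 \<le> 4" "zv z 3 \<le> zv z ak" "zv z ak \<le> zv z lk" using cfg by (auto simp: config_def)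
  from cfg consider
      (mid) "zv z 3 = 4" "min (zv z ai) (zv z li) = 0" "zv z ai \<le> 4" "min (zv z aj) (zv z lj) = 1" "zv z aj \<le> 4"
    | (pos) "zv z lj = 1" "zv z aj = 4" "min (zv z 3) (min (zv z ai) (zv z li)) = 0" "zv z ai \<le> max (zv z 3) (zv z li)"
    | (neg) "zv z li = 0" "zv z ai = 4" "min (zv z 3) (min (zv z aj) (zv z lj)) = 1" "zv z aj \<le> max (zv z 3) (zv z lj)"
    unfolding config_def by blast
  thus ?thesis
  proof cases
    case mid
    obtain p where p: "p \<in> {li, ai}" "zv z p = 0" using mid(2) by (auto simp: min_def split: if_splits)
    obtain q where q: "q \<in> {lj, aj}" "zv z q = 1" using mid(4) by (auto simp: min_def split: if_splits)
    have p3: "linked z 4 p 3" and q3: "linked z 4 q 3"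
      using linked_to_center[OF A(1) p(1)] linked_to_center[OF A(2) q(1)] p q mid by auto
    have "0 \<le> zv z v \<and> (linked z (zv z v) v p \<or> (1 \<le> zv z v \<and> linked z (zv z v) v q))"
      if "v \<in> T_vertices" for v
    proof -
      consider "v = 3" | "v \<in> {li, ai}" | "v \<in> {lj, aj}" | "v \<in> {lk, ak}" using \<open>v \<in> T_vertices\<close> unfolding V by blast
      thus ?thesis
      proof cases
        case 1 thus ?thesis using mid p3 linked_sym by auto
      next
        case 2
        hence "0 \<le> zv z v" using mid(2) by auto
        thus ?thesis using linked_within_arm[OF A(1) 2 p(1)] p(2) by auto
      next
        case 3
        hence "1 \<le> zv z v" using mid(4) by auto
        thus ?thesis using linked_within_arm[OF A(2) 3 q(1)] q(2) by auto
      next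
        case 4
        hence "4 \<le> zv z v" "zv z ak \<le> zv z v" using k mid(1) by auto
        hence "linked z (zv z v) v 3" "linked z (zv z v) 3 p"
          using linked_to_center[OF A(3) 4] mid(1) linked_mono[OF linked_sym[OF p3]] by auto
        thus ?thesis using \<open>4 \<le> zv z v\<close> by (auto intro: rtranclp_trans)
      qed
    qed
    moreover have "linked z 4 p q" using p3 q3 linked_sym rtranclp_trans by metis
    moreover have "\<not> linked z s p q" if "s < 4" for s
      using arm_cut[OF A(1) _ p(1), of z s q] q d mid(1) that by auto
    moreover have "p \<in> T_vertices" "q \<in> T_vertices" using p q V by auto
    ultimately have "two_valleys z p q" using p(2) q(2) unfolding two_valleys_def by blast
    thus ?thesis by blast
  next
    case pos
    obtain p where p: "p \<in> {3, li, ai}" "zv z p = 0"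
      and p_lnk: "\<And>v. v \<in> {3, li, ai} \<Longrightarrow> 0 \<le> zv z v \<and> linked z (zv z v) v p"
      using valley_over_center[OF A(1) pos(3,4)] by blast
    have "0 \<le> zv z v \<and> (linked z (zv z v) v p \<or> (1 \<le> zv z v \<and> linked z (zv z v) v lj))"
      if "v \<in> T_vertices" for v
    proof -
      consider "v \<in> {3, li, ai}" | "v \<in> {lj, aj}" | "v \<in> {lk, ak}" using \<open>v \<in> T_vertices\<close> unfolding V by blast
      thus ?thesis
      proof cases
        case 1 thus ?thesis using p_lnk by blast
      next
        case 2 thus ?thesis using linked_within_arm[OF A(2) 2, of lj z "zv z v"] pos by auto
      next
        case 3
        hence "zv z 3 \<le> zv z v" "zv z ak \<le> zv z v" using k by auto
        hence "linked z (zv z v) v 3" "linked z (zv z v) 3 p" "0 \<le> zv z v"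
          using linked_to_center[OF A(3) 3] linked_mono p_lnk[of 3] by auto
        thus ?thesis by (auto intro: rtranclp_trans)
      qed
    qed
    moreover have "linked z 4 p lj"
    proof -
      have "linked z 4 lj 3" using linked_to_center[OF A(2), of lj z 4] pos k by auto
      moreover have "linked z 4 3 p" using linked_mono p_lnk[of 3] k by auto
      ultimately show ?thesis using linked_sym rtranclp_trans by metis
    qed
    moreover have "\<not> linked z s p lj" if "s < 4" for s
      using arm_cut[OF A(2) linked_sym, of z s p lj] p d pos(2) that by auto
    moreover have "p \<in> T_vertices" "lj \<in> T_vertices" using p V by auto
    ultimately have "two_valleys z p lj" using p(2) pos(1) unfolding two_valleys_def by blast
    thus ?thesis by blast
  next
    case neg
    obtain q where q: "q \<in> {3, lj, aj}" "zv z q = 1"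
      and q_lnk: "\<And>v. v \<in> {3, lj, aj} \<Longrightarrow> 1 \<le> zv z v \<and> linked z (zv z v) v q"
      using valley_over_center[OF A(2) neg(3,4)] by blast
    have "0 \<le> zv z v \<and> (linked z (zv z v) v li \<or> (1 \<le> zv z v \<and> linked z (zv z v) v q))"
      if "v \<in> T_vertices" for v
    proof -
      consider "v \<in> {3, lj, aj}" | "v \<in> {li, ai}" | "v \<in> {lk, ak}" using \<open>v \<in> T_vertices\<close> unfolding V by blast
      thus ?thesis
      proof cases
        case 1 thus ?thesis using q_lnk[OF 1] by auto
      next
        case 2 thus ?thesis using linked_within_arm[OF A(1) 2, of li z "zv z v"] neg by auto
      next
        case 3
        hence "zv z 3 \<le> zv z v" "zv z ak \<le> zv z v" using k by auto
        hence "linked z (zv z v) v 3" "linked z (zv z v) 3 q" "1 \<le> zv z v"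
          using linked_to_center[OF A(3) 3] linked_mono q_lnk[of 3] by auto
        thus ?thesis by (auto intro: rtranclp_trans)
      qed
    qed
    moreover have "linked z 4 li q"
    proof -
      have "linked z 4 li 3" using linked_to_center[OF A(1), of li z 4] neg k by auto
      moreover have "linked z 4 3 q" using linked_mono q_lnk[of 3] k by auto
      ultimately show ?thesis using rtranclp_trans by metis
    qed
    moreover have "\<not> linked z s li q" if "s < 4" for s
      using arm_cut[OF A(1), of z s li q] q d neg(2) that by auto
    moreover have "li \<in> T_vertices" "q \<in> T_vertices" using q V by auto
    ultimately have "two_valleys z li q" using q(2) neg(1) unfolding two_valleys_def by blast
    thus ?thesis by blast
  qed
qed

lemma data_P_iff_config:
  "z \<in> data_P \<longleftrightarrow> (\<exists>li ai lj aj lk ak. arms li ai lj aj lk ak \<and>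
     config (zv z 3) (zv z li) (zv z ai) (zv z lj) (zv z aj) (zv z lk) (zv z ak))"
  by (metis data_P_imp_two_valleys two_valleys_imp_data_P two_valleys_imp_config config_imp_two_valleys)

section \<open>Deformation retraction\<close>

definition vec_of :: "(nat \<Rightarrow> real) \<Rightarrow> real^7" where
  "vec_of f = (\<chi> k. f (THE i. i \<in> T_vertices \<and> of_nat (i - 1) = k))"

text \<open>Each index is represented by an integer from 0 to 6, which gives surjectivity;
  injectivity follows by counting, both sides having seven elements.\<close>

lemma bij_betw_vertices_index: "bij_betw (\<lambda>i. of_nat (i - 1) :: 7) T_vertices UNIV"
proof -
  have "k \<in> (\<lambda>i. of_nat (i - 1)) ` T_vertices" for k :: 7
  proof (cases k rule: bit1_cases)
    case (of_int n)
    hence "k = of_nat (nat n + 1 - 1)" "nat n + 1 \<in> T_vertices" by (auto simp: T_vertices_def)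
    thus ?thesis by (rule image_eqI)
  qed
  hence surj: "(\<lambda>i. of_nat (i - 1) :: 7) ` T_vertices = UNIV" by auto
  moreover have "inj_on (\<lambda>i. of_nat (i - 1) :: 7) T_vertices"
    by (rule eq_card_imp_inj_on) (simp_all only: surj finite_T_vertices, simp add: T_vertices_def)
  ultimately show ?thesis by (simp add: bij_betw_def)
qed

lemma zv_vec_of [simp]:
  assumes "i \<in> T_vertices"
  shows "zv (vec_of f) i = f i"
proof -
  have "(THE j. j \<in> T_vertices \<and> of_nat (j - 1) = (of_nat (i - 1) :: 7)) = i"
    using assms bij_betw_vertices_index by (intro the_equality) (auto simp: bij_betw_def inj_on_def)
  thus ?thesis by (simp add: zv_def vec_of_def)
qed

lemma zv_ext:
  assumes "\<And>i. i \<in> T_vertices \<Longrightarrow> zv x i = zv y i"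
  shows "x = y"
proof -
  have "x $ k = y $ k" for k
  proof -
    have "k \<in> (\<lambda>i. of_nat (i - 1)) ` T_vertices"
      using bij_betw_imp_surj_on[OF bij_betw_vertices_index] by simp
    then obtain i where "i \<in> T_vertices" "k = of_nat (i - 1)" by blast
    thus ?thesis using assms by (simp add: zv_def)
  qed
  thus ?thesis by (simp add: vec_eq_iff)
qed

lemma continuous_on_vec_of:
  assumes "\<And>i. continuous_on S (\<lambda>x. f x i)"
  shows "continuous_on S (\<lambda>x. vec_of (f x))"
  unfolding vec_of_def by (intro continuous_on_vec_lambda assms)

lemma continuous_on_zv [continuous_intros]:
  "continuous_on S f \<Longrightarrow> continuous_on S (\<lambda>x. zv (f x) i)"
  unfolding zv_def by (intro continuous_intros)

lemma zv_segment: "zv ((1 - t) *\<^sub>R x + t *\<^sub>R y) i = (1 - t) * zv x i + t * zv y i"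
  by (simp add: zv_def)

definition mate :: "nat \<Rightarrow> nat" where
  "mate v = (if odd v then if v = 1 then 2 else v - 1 else if v = 2 then 1 else v + 1)"

text \<open>Leaves are the odd vertices 1, 5, 7 and \<open>mate\<close> exchanges the two vertices
  of an arm. One formula thus serves all three arms without a choice of labelling, and continuity is
  immediate.\<close>

definition star :: "real \<Rightarrow> (nat \<Rightarrow> nat \<Rightarrow> real) \<Rightarrow> (nat \<Rightarrow> nat \<Rightarrow> real) \<Rightarrow> real^7" where
  "star c L A = vec_of (\<lambda>v. if v = 3 then c else if odd v then L v (mate v) else A (mate v) v)"

lemma zv_star_center [simp]: "zv (star c L A) 3 = c"
  by (simp add: star_def T_vertices_def)

lemma zv_star_arm:
  assumes "arm l a"
  shows "zv (star c L A) l = L l a" "zv (star c L A) a = A l a"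
  using assms by (auto simp: star_def arm_def mate_def T_vertices_def)

lemma continuous_on_star:
  assumes "continuous_on S c" "\<And>l a. continuous_on S (\<lambda>x. L x l a)" "\<And>l a. continuous_on S (\<lambda>x. A x l a)"
  shows "continuous_on S (\<lambda>x. star (c x) (L x) (A x))"
  unfolding star_def
proof (rule continuous_on_vec_of)
  fix i show "continuous_on S (\<lambda>x. if i = 3 then c x else if odd i then L x i (mate i) else A x (mate i) i)"
    using assms by (cases "i = 3"; cases "odd i") auto
qed

lemma star_ext:
  assumes "zv x 3 = zv y 3" "\<And>l a. arm l a \<Longrightarrow> zv x l = zv y l \<and> zv x a = zv y a"
  shows "x = y"
proof (rule zv_ext)
  fix i assume "i \<in> T_vertices"
  thus "zv x i = zv y i" by (cases i rule: vertex_cases) (use assms in auto)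
qed

section \<open>The two retracting maps and their effect on configurations\<close>

definition lower_leaves :: "real^7 \<Rightarrow> real^7" where
  "lower_leaves z = star (zv z 3) (\<lambda>l a. min (zv z l) (zv z a)) (\<lambda>l a. zv z a)"

text \<open>For the configurations in question this equals \<open>4\<close> on the arm carrying the separating
  value and the centre value \<open>c\<close> on the two other arms.\<close>
definition level :: "real \<Rightarrow> real \<Rightarrow> real \<Rightarrow> real" where
  "level c l a = min 4 (c + 2 * max 0 (a - max l c))"

definition flatten :: "real^7 \<Rightarrow> real^7" where
  "flatten z = star (zv z 3) (\<lambda>l a. min (zv z l) (level (zv z 3) (zv z l) (zv z a)))
     (\<lambda>l a. level (zv z 3) (zv z l) (zv z a))"

text \<open>The normal form after both maps: labelling and disjunct given, \<open>c\<close>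
  determines everything. In the first disjunct the centre belongs to the valley of depth 0, in the
  second to that of depth 1; they agree at \<open>c = 4\<close>.\<close>

definition ridge :: "real \<Rightarrow> real \<Rightarrow> real \<Rightarrow> real \<Rightarrow> real \<Rightarrow> real \<Rightarrow> real \<Rightarrow> bool" where
  "ridge c li ai lj aj lk ak \<longleftrightarrow> li = 0 \<and> lj = 1 \<and> lk = c \<and> ak = c \<and> c \<le> 4 \<and>
     (0 \<le> c \<and> ai = c \<and> aj = 4 \<or> 1 \<le> c \<and> ai = 4 \<and> aj = c)"

text \<open>A leaf value already at most its inner value cannot move; a greater one stays at least
  the inner value. The minima and upper bounds in \<open>config\<close> survive either way.
  Intermediate values are allowed so that whole segments are covered.\<close>

lemma config_lower_leaves:
  assumes "config c li ai lj aj lk ak"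
    "min li ai \<le> li'" "li' \<le> li" "min lj aj \<le> lj'" "lj' \<le> lj" "min lk ak \<le> lk'" "lk' \<le> lk"
  shows "config c li' ai lj' aj lk' ak"
proof -
  have "ak \<le> lk'" using assms by (auto simp: config_def)
  from assms(1) consider
      "c = 4" "min ai li = 0" "ai \<le> 4" "min aj lj = 1" "aj \<le> 4"
    | "lj = 1" "aj = 4" "min c (min ai li) = 0" "ai \<le> max c li"
    | "li = 0" "ai = 4" "min c (min aj lj) = 1" "aj \<le> max c lj"
    unfolding config_def by blast
  thus ?thesis
  proof cases
    case 1
    hence "min ai li' = 0" "min aj lj' = 1" using assms(2-5) by linarith+
    thus ?thesis using 1 assms(1) \<open>ak \<le> lk'\<close> by (auto simp: config_def)
  next
    case 2
    hence "min c (min ai li') = 0" "ai \<le> max c li'" "lj' = 1" using assms(2-5) by linarith+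
    thus ?thesis using 2 assms(1) \<open>ak \<le> lk'\<close> by (auto simp: config_def)
  next
    case 3
    hence "min c (min aj lj') = 1" "aj \<le> max c lj'" "li' = 0" using assms(2-5) by linarith+
    thus ?thesis using 3 assms(1) \<open>ak \<le> lk'\<close> by (auto simp: config_def)
  qed
qed

text \<open>With no leaf above its inner vertex, the bottom of a valley extending over the centre is
  at the leaf or at the centre. If the centre is the bottom, the bound on the inner value forces
  leaf and inner value to agree.\<close>

lemma lowered_config_cases:
  assumes "config c li ai lj aj lk ak" "li \<le> ai" "lj \<le> aj" "lk \<le> ak"
  obtains (mid) "c = 4" "lk = ak" "4 \<le> ak" "li = 0" "0 \<le> ai" "ai \<le> 4" "lj = 1" "1 \<le> aj" "aj \<le> 4"
    | (pos) "0 \<le> c" "c \<le> 4" "lk = ak" "c \<le> ak" "lj = 1" "aj = 4" "li = 0 \<and> 0 \<le> ai \<and> ai \<le> c \<or> c = 0 \<and> li = ai \<and> 0 \<le> ai"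
    | (neg) "1 \<le> c" "c \<le> 4" "lk = ak" "c \<le> ak" "li = 0" "ai = 4" "lj = 1 \<and> 1 \<le> aj \<and> aj \<le> c \<or> c = 1 \<and> lj = aj \<and> 1 \<le> aj"
proof -
  have k: "lk = ak" "c \<le> ak" "c \<le> 4" using assms by (auto simp: config_def)
  from assms(1) consider
      "c = 4" "min ai li = 0" "ai \<le> 4" "min aj lj = 1" "aj \<le> 4"
    | "lj = 1" "aj = 4" "min c (min ai li) = 0" "ai \<le> max c li"
    | "li = 0" "ai = 4" "min c (min aj lj) = 1" "aj \<le> max c lj"
    unfolding config_def by blast
  thus thesis
  proof cases
    case 1 thus thesis using k assms(2,3) by (intro mid) auto
  next
    case 2 thus thesis using k assms(2,3) by (intro pos) linarith+
  next
    case 3 thus thesis using k assms(2,3) by (intro neg) linarith+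
  qed
qed

text \<open>The factor 2 in \<open>level\<close> matters for leaf value 1 and inner value 4: if
  \<open>c < 1\<close>, then \<open>c + (4 - 1)\<close> falls short of 4, whereas
  \<open>c + 2 * (4 - max 1 c)\<close> does not for \<open>0 \<le> c \<le> 4\<close>.\<close>

lemma level_eqs:
  "l \<le> 4 \<Longrightarrow> a \<le> 4 \<Longrightarrow> level 4 l a = 4"
  "a \<le> l \<Longrightarrow> c \<le> 4 \<Longrightarrow> level c l a = c"
  "a \<le> c \<Longrightarrow> c \<le> 4 \<Longrightarrow> level c l a = c"
  "c \<le> 4 \<Longrightarrow> 0 \<le> c \<Longrightarrow> level c 1 4 = 4"
  "c \<le> 4 \<Longrightarrow> 0 \<le> c \<Longrightarrow> level c 0 4 = 4"
  by (simp_all add: level_def)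

lemma ridge_of_config:
  assumes "config c li ai lj aj lk ak" "li \<le> ai" "lj \<le> aj" "lk \<le> ak"
  shows "ridge c (min li (level c li ai)) (level c li ai) (min lj (level c lj aj)) (level c lj aj)
    (min lk (level c lk ak)) (level c lk ak)"
  using assms
proof (cases rule: lowered_config_cases)
  case mid
  thus ?thesis by (auto simp: ridge_def level_eqs)
next
  case pos
  hence "level c li ai = c" by (auto simp: level_eqs)
  thus ?thesis using pos by (auto simp: ridge_def level_eqs)
next
  case neg
  hence "level c lj aj = c" by (auto simp: level_eqs)
  thus ?thesis using neg by (auto simp: ridge_def level_eqs)
qed

text \<open>The case of \<open>lowered_config_cases\<close> persists along the segment. Prescribed
  values agree at both ends, and the others obey common convex bounds. Where leaf and inner value
  are equal they move together.\<close>

lemma config_flatten_segment: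
  fixes t :: real
  assumes "config c li ai lj aj lk ak" "li \<le> ai" "lj \<le> aj" "lk \<le> ak" "0 \<le> t" "t \<le> 1"
  defines "S \<equiv> \<lambda>x y. (1 - t) * x + t * y"
  shows "config c (S li (min li (level c li ai))) (S ai (level c li ai))
    (S lj (min lj (level c lj aj))) (S aj (level c lj aj)) (S lk (min lk (level c lk ak))) (S ak (level c lk ak))"
proof -
  have S_same: "S x x = x" for x by (simp add: S_def algebra_simps)
  have S_ge: "m \<le> S x y" if "m \<le> x" "m \<le> y" for m x y
    using convex_bound_le[of "-x" "-m" "-y" "1-t" t] that assms(5,6) by (simp add: S_def)
  have S_le: "S x y \<le> m" if "x \<le> m" "y \<le> m" for m x y
    using convex_bound_le[of x m y "1-t" t] that assms(5,6) by (simp add: S_def)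
  from assms(1-4) show ?thesis
  proof (cases rule: lowered_config_cases)
    case mid
    thus ?thesis using S_ge[of 0 ai 4] S_le[of ai 4 4] S_ge[of 1 aj 4] S_le[of aj 4 4] S_ge[of 4 ak 4]
      by (auto simp: config_def level_eqs S_same)
  next
    case pos
    hence i: "level c li ai = c" by (auto simp: level_eqs)
    have "min c (min (S ai c) (S li (min li c))) = 0 \<and> S ai c \<le> max c (S li (min li c))"
      using pos(1,7) S_ge[of 0 ai c] S_le[of ai c c] by (auto simp: S_same)
    thus ?thesis using pos i S_ge[of c ak c] by (auto simp: config_def level_eqs S_same)
  next
    case neg
    hence j: "level c lj aj = c" by (auto simp: level_eqs)
    have "min c (min (S aj c) (S lj (min lj c))) = 1 \<and> S aj c \<le> max c (S lj (min lj c))"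
      using neg(1,7) S_ge[of 1 aj c] S_le[of aj c c] by (auto simp: S_same)
    thus ?thesis using neg j S_ge[of c ak c] by (auto simp: config_def level_eqs S_same)
  qed
qed

lemma ridge_imp_config: "ridge c li ai lj aj lk ak \<Longrightarrow> config c li ai lj aj lk ak"
  by (auto simp: ridge_def config_def)

lemma ridge_fixed:
  assumes "ridge c li ai lj aj lk ak"
  shows "li \<le> ai" "lj \<le> aj" "lk \<le> ak" "level c li ai = ai" "level c lj aj = aj" "level c lk ak = ak"
  using assms by (auto simp: ridge_def level_eqs)

definition ridges :: "(real^7) set" where
  "ridges = {z. \<exists>li ai lj aj lk ak. arms li ai lj aj lk ak \<and>
     ridge (zv z 3) (zv z li) (zv z ai) (zv z lj) (zv z aj) (zv z lk) (zv z ak)}"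

lemma continuous_on_lower_leaves: "continuous_on S lower_leaves"
  unfolding lower_leaves_def by (intro continuous_on_star continuous_intros)

lemma continuous_on_flatten: "continuous_on S flatten"
  unfolding flatten_def level_def by (intro continuous_on_star continuous_intros)

lemma lower_leaves_segment:
  assumes "z \<in> data_P"
  shows "closed_segment z (lower_leaves z) \<subseteq> data_P"
proof
  fix x assume "x \<in> closed_segment z (lower_leaves z)"
  then obtain t where t: "0 \<le> t" "t \<le> 1" and x: "x = (1 - t) *\<^sub>R z + t *\<^sub>R lower_leaves z"
    by (auto simp: in_segment)
  obtain li ai lj aj lk ak where arms: "arms li ai lj aj lk ak" and
    cfg: "config (zv z 3) (zv z li) (zv z ai) (zv z lj) (zv z aj) (zv z lk) (zv z ak)"
    using assms by (auto simp: data_P_iff_config)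
  have A: "arm li ai" "arm lj aj" "arm lk ak" using arms by (auto simp: arms_def)
  have seg: "min p q \<le> (1 - t) * p + t * min p q" "(1 - t) * p + t * min p q \<le> p" for p q :: real
    using convex_bound_le[of "-p" "- min p q" "- min p q" "1-t" t]
      convex_bound_le[of p p "min p q" "1-t" t] t by auto
  have same: "(1 - t) * p + t * p = p" for p :: real by (simp add: algebra_simps)
  have "config (zv x 3) (zv x li) (zv x ai) (zv x lj) (zv x aj) (zv x lk) (zv x ak)"
    unfolding x zv_segment lower_leaves_def zv_star_arm[OF A(1)] zv_star_arm[OF A(2)] zv_star_arm[OF A(3)]
      zv_star_center same
    by (rule config_lower_leaves[OF cfg]) (rule seg)+
  thus "x \<in> data_P" using arms unfolding data_P_iff_config by blast
qed

lemma lowered_config: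
  assumes "z \<in> data_P"
  obtains li ai lj aj lk ak where "arms li ai lj aj lk ak"
    "config (zv (lower_leaves z) 3) (zv (lower_leaves z) li) (zv (lower_leaves z) ai)
       (zv (lower_leaves z) lj) (zv (lower_leaves z) aj) (zv (lower_leaves z) lk) (zv (lower_leaves z) ak)"
    "zv (lower_leaves z) li \<le> zv (lower_leaves z) ai" "zv (lower_leaves z) lj \<le> zv (lower_leaves z) aj"
    "zv (lower_leaves z) lk \<le> zv (lower_leaves z) ak"
proof -
  have "lower_leaves z \<in> data_P" using lower_leaves_segment[OF assms] by auto
  then obtain li ai lj aj lk ak where arms: "arms li ai lj aj lk ak" and
    cfg: "config (zv (lower_leaves z) 3) (zv (lower_leaves z) li) (zv (lower_leaves z) ai)
       (zv (lower_leaves z) lj) (zv (lower_leaves z) aj) (zv (lower_leaves z) lk) (zv (lower_leaves z) ak)"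
    by (auto simp: data_P_iff_config)
  have le: "zv (lower_leaves z) l \<le> zv (lower_leaves z) a" if "arm l a" for l a
    by (simp add: lower_leaves_def zv_star_arm[OF that])
  show thesis using that[OF arms cfg] le arms by (auto simp: arms_def)
qed

lemma flatten_segment:
  assumes "z \<in> data_P"
  shows "closed_segment (lower_leaves z) (flatten (lower_leaves z)) \<subseteq> data_P"
proof
  fix x assume "x \<in> closed_segment (lower_leaves z) (flatten (lower_leaves z))"
  then obtain t where t: "0 \<le> t" "t \<le> 1"
    and x: "x = (1 - t) *\<^sub>R lower_leaves z + t *\<^sub>R flatten (lower_leaves z)"
    by (auto simp: in_segment)
  obtain li ai lj aj lk ak where arms: "arms li ai lj aj lk ak" and
    cfg: "config (zv (lower_leaves z) 3) (zv (lower_leaves z) li) (zv (lower_leaves z) ai)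
       (zv (lower_leaves z) lj) (zv (lower_leaves z) aj) (zv (lower_leaves z) lk) (zv (lower_leaves z) ak)"
    "zv (lower_leaves z) li \<le> zv (lower_leaves z) ai" "zv (lower_leaves z) lj \<le> zv (lower_leaves z) aj"
    "zv (lower_leaves z) lk \<le> zv (lower_leaves z) ak"
    using lowered_config[OF assms] by blast
  have A: "arm li ai" "arm lj aj" "arm lk ak" using arms by (auto simp: arms_def)
  have same: "(1 - t) * p + t * p = p" for p :: real by (simp add: algebra_simps)
  have "config (zv x 3) (zv x li) (zv x ai) (zv x lj) (zv x aj) (zv x lk) (zv x ak)"
    unfolding x zv_segment flatten_def zv_star_arm[OF A(1)] zv_star_arm[OF A(2)] zv_star_arm[OF A(3)]
      zv_star_center same
    by (rule config_flatten_segment[OF cfg t])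
  thus "x \<in> data_P" using arms unfolding data_P_iff_config by blast
qed

lemma flatten_in_ridges:
  assumes "z \<in> data_P"
  shows "flatten (lower_leaves z) \<in> ridges"
proof -
  obtain li ai lj aj lk ak where arms: "arms li ai lj aj lk ak" and
    cfg: "config (zv (lower_leaves z) 3) (zv (lower_leaves z) li) (zv (lower_leaves z) ai)
       (zv (lower_leaves z) lj) (zv (lower_leaves z) aj) (zv (lower_leaves z) lk) (zv (lower_leaves z) ak)"
    "zv (lower_leaves z) li \<le> zv (lower_leaves z) ai" "zv (lower_leaves z) lj \<le> zv (lower_leaves z) aj"
    "zv (lower_leaves z) lk \<le> zv (lower_leaves z) ak"
    using lowered_config[OF assms] by blast
  have A: "arm li ai" "arm lj aj" "arm lk ak" using arms by (auto simp: arms_def)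
  let ?f = "flatten (lower_leaves z)"
  have "ridge (zv ?f 3) (zv ?f li) (zv ?f ai) (zv ?f lj) (zv ?f aj) (zv ?f lk) (zv ?f ak)"
    unfolding flatten_def zv_star_arm[OF A(1)] zv_star_arm[OF A(2)] zv_star_arm[OF A(3)] zv_star_center
    by (rule ridge_of_config[OF cfg])
  thus ?thesis using arms unfolding ridges_def by blast
qed

lemma arms_exhaust:
  assumes "arms li ai lj aj lk ak" "arm l a"
  shows "l = li \<and> a = ai \<or> l = lj \<and> a = aj \<or> l = lk \<and> a = ak"
  using assms by (auto simp: arms_def arm_def)

lemma ridges_fixed:
  assumes "z \<in> ridges"
  shows "flatten (lower_leaves z) = z"
proof -
  obtain li ai lj aj lk ak where arms: "arms li ai lj aj lk ak" and
    rdg: "ridge (zv z 3) (zv z li) (zv z ai) (zv z lj) (zv z aj) (zv z lk) (zv z ak)"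
    using assms by (auto simp: ridges_def)
  have fixed: "zv z l \<le> zv z a \<and> level (zv z 3) (zv z l) (zv z a) = zv z a" if "arm l a" for l a
    using arms_exhaust[OF arms that] ridge_fixed[OF rdg] by blast
  have "lower_leaves z = z"
    by (rule star_ext) (simp_all add: lower_leaves_def zv_star_arm fixed min_absorb1)
  moreover have "flatten z = z"
    by (rule star_ext) (simp_all add: flatten_def zv_star_arm fixed min_absorb1)
  ultimately show ?thesis by simp
qed

text \<open>The two straight-line homotopies, joined end to end, deform the identity inside
  \<open>data_P\<close> to a map into \<open>ridges\<close> that fixes \<open>ridges\<close>
  pointwise.\<close>

lemma data_P_homotopy_eqv_ridges: "data_P homotopy_eqv ridges"
proof (rule deformation_retract_imp_homotopy_eqv)
  have "homotopic_with_canon (\<lambda>x. True) data_P data_P id lower_leaves"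
    using lower_leaves_segment
    by (intro homotopic_with_linear continuous_on_id' continuous_on_lower_leaves) (auto simp: id_def)
  moreover have "homotopic_with_canon (\<lambda>x. True) data_P data_P lower_leaves (flatten \<circ> lower_leaves)"
    using flatten_segment
    by (intro homotopic_with_linear continuous_on_compose continuous_on_flatten continuous_on_lower_leaves) auto
  ultimately show "homotopic_with_canon (\<lambda>x. True) data_P data_P id (flatten \<circ> lower_leaves)"
    by (rule homotopic_with_trans)
  have "ridges \<subseteq> data_P" using ridge_imp_config by (fastforce simp: ridges_def data_P_iff_config)
  thus "retraction data_P ridges (flatten \<circ> lower_leaves)"
    unfolding retraction_def using flatten_in_ridges ridges_fixed
      continuous_on_compose[OF continuous_on_lower_leaves continuous_on_flatten] by auto
qed

section \<open>The hexagon\<close>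

definition hexagon :: "(real \<times> real \<times> real) set" where
  "hexagon = {(x, y, w). max x (max y w) = 1 \<and> min x (min y w) = -1}"

text \<open>The composite of the linear isomorphism of the plane with the quotient of \<open>\<real>\<^sup>3\<close> by the
  diagonal and the section of that quotient that normalises maximum and minimum to \<open>1\<close> and \<open>-1\<close>.\<close>
definition hex_proj :: "complex \<Rightarrow> real \<times> real \<times> real" where
  "hex_proj z = (let M = max (Re z) (max (Im z) 0); m = min (Re z) (min (Im z) 0) in
     ((2 * Re z - (M + m)) / (M - m), (2 * Im z - (M + m)) / (M - m), - (M + m) / (M - m)))"

lemma spread_pos: "z \<noteq> 0 \<Longrightarrow> 0 < max (Re z) (max (Im z) 0) - min (Re z) (min (Im z) 0)"
  by (auto simp: complex_eq_iff)

lemma continuous_on_hex_proj: "continuous_on (sphere 0 1) hex_proj"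
proof -
  have "z \<noteq> 0" if "z \<in> sphere 0 1" for z :: complex using that by auto
  hence "max (Re z) (max (Im z) 0) - min (Re z) (min (Im z) 0) \<noteq> 0" if "z \<in> sphere 0 1" for z :: complex
    using spread_pos[of z] that by fastforce
  thus ?thesis unfolding hex_proj_def Let_def
    by (intro continuous_intros) auto
qed

text \<open>Numerators and denominator are homogeneous of degree one, so the factor cancels. A
  preimage may therefore be sought among all nonzero numbers and normalised afterwards.\<close>

lemma hex_proj_scale:
  assumes "0 < r"
  shows "hex_proj (of_real r * z) = hex_proj z"
proof -
  have mx: "max (r * Re z) (max (r * Im z) 0) = r * max (Re z) (max (Im z) 0)"
    and mn: "min (r * Re z) (min (r * Im z) 0) = r * min (Re z) (min (Im z) 0)"
    using assms by (auto simp: max_def min_def zero_le_mult_iff mult_le_0_iff)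
  have q: "(2 * (r * u) - (r * p + r * q)) / (r * p - r * q) = (2 * u - (p + q)) / (p - q)"
    "- (r * p + r * q) / (r * p - r * q) = - (p + q) / (p - q)" for p q u
  proof -
    have "2 * (r * u) - (r * p + r * q) = r * (2 * u - (p + q))" "r * p - r * q = r * (p - q)"
      "- (r * p + r * q) = r * - (p + q)" by (simp_all add: algebra_simps)
    thus "(2 * (r * u) - (r * p + r * q)) / (r * p - r * q) = (2 * u - (p + q)) / (p - q)"
      "- (r * p + r * q) / (r * p - r * q) = - (p + q) / (p - q)"
      using assms by simp_all
  qed
  have "Re (of_real r * z) = r * Re z" "Im (of_real r * z) = r * Im z" by simp_all
  thus ?thesis by (simp only: hex_proj_def Let_def mx mn q)
qed

text \<open>The coordinates are the images of \<open>Re z\<close>, \<open>Im z\<close> and 0 under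
  one increasing affine map sending \<open>M\<close> to 1 and \<open>m\<close> to -1, and monotone
  maps commute with \<open>max\<close> and \<open>min\<close>.\<close>

lemma hex_proj_in_hexagon:
  assumes "z \<noteq> 0"
  shows "hex_proj z \<in> hexagon"
proof -
  define M where "M = max (Re z) (max (Im z) 0)"
  define m where "m = min (Re z) (min (Im z) 0)"
  have "0 < M - m" using spread_pos[OF assms] by (simp add: M_def m_def)
  define f where "f u = (2 * u - (M + m)) / (M - m)" for u
  have f_mono: "mono f"
    using \<open>0 < M - m\<close> by (auto simp: mono_def f_def divide_right_mono)
  have "hex_proj z = (f (Re z), f (Im z), f 0)"
    by (simp add: hex_proj_def Let_def f_def M_def m_def)
  moreover have "max (f (Re z)) (max (f (Im z)) (f 0)) = f M"
    by (simp add: M_def max_of_mono[OF f_mono])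
  moreover have "min (f (Re z)) (min (f (Im z)) (f 0)) = f m"
    by (simp add: m_def min_of_mono[OF f_mono])
  moreover have "f M = 1" "f m = -1" using \<open>0 < M - m\<close> by (auto simp: f_def field_simps)
  ultimately show ?thesis by (simp add: hexagon_def)
qed

text \<open>Subtracting \<open>w\<close> moves the point along the diagonal until its third
  coordinate is 0. The spread remains 2, and recentring restores the point.\<close>

lemma hex_proj_section:
  assumes "(x, y, w) \<in> hexagon"
  shows "hex_proj (Complex (x - w) (y - w)) = (x, y, w)"
proof -
  have "max (x - w) (max (y - w) 0) = 1 - w" "min (x - w) (min (y - w) 0) = - 1 - w"
    using assms unfolding hexagon_def by auto
  thus ?thesis by (simp add: hex_proj_def Let_def)
qed

text \<open>Differences of coordinates eliminate \<open>M + m\<close>, so the image determines the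
  ray of \<open>z\<close>. Together with \<open>norm z = 1\<close> this gives injectivity on the
  circle.\<close>

lemma hex_proj_eq_imp:
  assumes "z \<noteq> 0" "hex_proj z = (x, y, w)"
  obtains r where "0 < r" "Complex (x - w) (y - w) = of_real r * z"
proof -
  define M where "M = max (Re z) (max (Im z) 0)"
  define m where "m = min (Re z) (min (Im z) 0)"
  have "0 < M - m" using spread_pos[OF assms(1)] by (simp add: M_def m_def)
  moreover have "x = (2 * Re z - (M + m)) / (M - m)" "y = (2 * Im z - (M + m)) / (M - m)"
      "w = - (M + m) / (M - m)"
    using assms(2) by (simp_all add: hex_proj_def Let_def M_def m_def)
  hence "Complex (x - w) (y - w) = of_real (2 / (M - m)) * z"
    by (simp add: complex_eq_iff flip: diff_divide_distrib)
  ultimately show thesis by (intro that[of "2 / (M - m)"]) auto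
qed

lemma hex_proj_image: "hex_proj ` sphere 0 1 = hexagon"
proof (intro equalityI subsetI)
  fix u assume "u \<in> hexagon"
  then obtain x y w where u: "u = (x, y, w)" "(x, y, w) \<in> hexagon" by (cases u) auto
  let ?z = "Complex (x - w) (y - w)"
  have "?z \<noteq> 0" using u(2) by (auto simp: hexagon_def complex_eq_iff)
  have "hex_proj (of_real (inverse (norm ?z)) * ?z) = u"
    using hex_proj_scale[of "inverse (norm ?z)" ?z] \<open>?z \<noteq> 0\<close> hex_proj_section[OF u(2)] u(1) by simp
  moreover have "of_real (inverse (norm ?z)) * ?z \<in> sphere 0 1"
    using \<open>?z \<noteq> 0\<close> by (simp add: norm_mult del: of_real_inverse)
  ultimately show "u \<in> hex_proj ` sphere 0 1" by (metis image_eqI)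
next
  fix u assume "u \<in> hex_proj ` sphere 0 1"
  then obtain z where "u = hex_proj z" "z \<noteq> 0" by fastforce
  thus "u \<in> hexagon" using hex_proj_in_hexagon by simp
qed

lemma inj_on_hex_proj: "inj_on hex_proj (sphere 0 1)"
proof (rule inj_onI)
  fix z z' assume z: "z \<in> sphere 0 1" "z' \<in> sphere 0 1" and eq: "hex_proj z = hex_proj z'"
  obtain x y w where u: "hex_proj z = (x, y, w)" by (cases "hex_proj z") auto
  have nz: "norm z = 1" "norm z' = 1" "z \<noteq> 0" "z' \<noteq> 0" using z by auto
  obtain r where r: "0 < r" "Complex (x - w) (y - w) = of_real r * z"
    using hex_proj_eq_imp[OF nz(3) u] by blast
  obtain r' where r': "0 < r'" "Complex (x - w) (y - w) = of_real r' * z'"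
    using hex_proj_eq_imp[OF nz(4)] u eq by metis
  have "r = norm (of_real r * z)" "r' = norm (of_real r' * z')"
    using nz r(1) r'(1) by (simp_all add: norm_mult)
  hence "r = r'" using r(2) r'(2) by metis
  thus "z = z'" using r r' by auto
qed

section \<open>Signed heights and the homeomorphism from the hexagon to the ridges\<close>

text \<open>Signed heights are scaled so that \<open>1\<close> is the bottom of the valley of depth \<open>0\<close>, \<open>-1\<close> that of
  the valley of depth \<open>1\<close>, and \<open>0\<close> the separating value \<open>4\<close>; \<open>depth\<close> recovers the value.\<close>
definition depth :: "real \<Rightarrow> real" where
  "depth y = 4 - 4 * max y 0 + 3 * min y 0"

text \<open>The signed height of the inner vertex of an arm with leaf height \<open>u\<close> and centre height \<open>s\<close>:
  it equals \<open>s\<close>, except on the arm with \<open>u = \<plusminus>1\<close> of sign opposite to \<open>s\<close>, where it is \<open>0\<close>.\<close>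
definition inner_coord :: "real \<Rightarrow> real \<Rightarrow> real" where
  "inner_coord s u = max 0 (s + min u 0) + min 0 (s + max u 0)"

definition hex_coord :: "real \<times> real \<times> real \<Rightarrow> nat \<Rightarrow> real" where
  "hex_coord u l = (if l = 1 then fst u else if l = 5 then fst (snd u) else snd (snd u))"

text \<open>On the hexagon the coordinates 1 and -1 cancel, so the sum is the remaining coordinate,
  obtained without naming its arm.\<close>

definition hex_sum :: "real \<times> real \<times> real \<Rightarrow> real" where
  "hex_sum u = fst u + fst (snd u) + snd (snd u)"

definition hex_ridge :: "real \<times> real \<times> real \<Rightarrow> real^7" where
  "hex_ridge u = star (depth (hex_sum u)) (\<lambda>l a. depth (hex_coord u l))
     (\<lambda>l a. depth (inner_coord (hex_sum u) (hex_coord u l)))"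

lemma continuous_on_hex_ridge: "continuous_on S hex_ridge"
proof -
  have "continuous_on S (\<lambda>u. hex_coord u l)" for l
    unfolding hex_coord_def by (cases "l = 1"; cases "l = 5") (auto intro!: continuous_intros)
  thus ?thesis unfolding hex_ridge_def depth_def inner_coord_def hex_sum_def
    by (intro continuous_on_star continuous_intros)
qed

lemma hex_sum_arms:
  "arms li ai lj aj lk ak \<Longrightarrow> hex_sum u = hex_coord u li + hex_coord u lj + hex_coord u lk"
  by (auto simp: arms_def arm_def hex_sum_def hex_coord_def)

text \<open>Each ordered choice of the arms with coordinates 1 and -1 gives one of the six edges,
  along which the third coordinate is free.\<close>

lemma hexagon_iff:
  "u \<in> hexagon \<longleftrightarrow> (\<exists>li ai lj aj lk ak. arms li ai lj aj lk ak \<and>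
     hex_coord u li = 1 \<and> hex_coord u lj = -1 \<and> hex_coord u lk \<in> {-1..1})"
proof
  obtain x y w where u: "u = (x, y, w)" by (cases u) auto
  have c: "hex_coord u 1 = x" "hex_coord u 5 = y" "hex_coord u 7 = w" by (simp_all add: u hex_coord_def)
  have A: "arms 1 2 5 4 7 6" "arms 1 2 7 6 5 4" "arms 5 4 1 2 7 6" "arms 5 4 7 6 1 2"
    "arms 7 6 1 2 5 4" "arms 7 6 5 4 1 2" by (simp_all add: arms_def arm_def)
  {
    assume "u \<in> hexagon"
    hence h: "max x (max y w) = 1" "min x (min y w) = -1" by (auto simp: hexagon_def u)
    hence "x \<in> {-1..1}" "y \<in> {-1..1}" "w \<in> {-1..1}" by auto
    moreover have "x = 1 \<or> y = 1 \<or> w = 1" "x = -1 \<or> y = -1 \<or> w = -1"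
      using h by (auto simp: max_def min_def split: if_splits)
    ultimately consider "x = 1" "y = -1" "w \<in> {-1..1}" | "x = 1" "w = -1" "y \<in> {-1..1}"
      | "y = 1" "x = -1" "w \<in> {-1..1}" | "y = 1" "w = -1" "x \<in> {-1..1}"
      | "w = 1" "x = -1" "y \<in> {-1..1}" | "w = 1" "y = -1" "x \<in> {-1..1}"
      by fastforce
    thus "\<exists>li ai lj aj lk ak. arms li ai lj aj lk ak \<and>
        hex_coord u li = 1 \<and> hex_coord u lj = -1 \<and> hex_coord u lk \<in> {-1..1}"
      using A c by cases metis+
  }
  assume "\<exists>li ai lj aj lk ak. arms li ai lj aj lk ak \<and>
     hex_coord u li = 1 \<and> hex_coord u lj = -1 \<and> hex_coord u lk \<in> {-1..1}"
  then obtain li ai lj aj lk ak where arms: "arms li ai lj aj lk ak" and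
    v: "hex_coord u li = 1" "hex_coord u lj = -1" "hex_coord u lk \<in> {-1..1}" by blast
  have "x \<in> {-1..1}" "y \<in> {-1..1}" "w \<in> {-1..1}" "1 \<in> {x, y, w}" "-1 \<in> {x, y, w}"
    using arms v by (auto simp: arms_def arm_def hex_coord_def u)
  thus "u \<in> hexagon" by (auto simp: hexagon_def u)
qed

lemma depth_eqs: "0 \<le> t \<Longrightarrow> depth t = 4 - 4 * t" "t \<le> 0 \<Longrightarrow> depth t = 4 + 3 * t"
  by (auto simp: depth_def)

lemma inner_coord_eqs:
  "0 \<le> t \<Longrightarrow> t \<le> 1 \<Longrightarrow> inner_coord t 1 = t" "0 \<le> t \<Longrightarrow> t \<le> 1 \<Longrightarrow> inner_coord t (-1) = 0"
  "t \<le> 0 \<Longrightarrow> -1 \<le> t \<Longrightarrow> inner_coord t 1 = 0" "t \<le> 0 \<Longrightarrow> -1 \<le> t \<Longrightarrow> inner_coord t (-1) = t"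
  "inner_coord t t = t"
  by (auto simp: inner_coord_def)

lemma hex_ridge_coords:
  assumes "arms li ai lj aj lk ak"
    and "hex_coord u li = 1" "hex_coord u lj = -1" "hex_coord u lk = t"
  shows "zv (hex_ridge u) 3 = depth t"
    "zv (hex_ridge u) li = 0" "zv (hex_ridge u) ai = depth (inner_coord t 1)"
    "zv (hex_ridge u) lj = 1" "zv (hex_ridge u) aj = depth (inner_coord t (-1))"
    "zv (hex_ridge u) lk = depth t" "zv (hex_ridge u) ak = depth t"
proof -
  have A: "arm li ai" "arm lj aj" "arm lk ak" using assms(1) by (auto simp: arms_def)
  have "hex_sum u = t" using hex_sum_arms[OF assms(1)] assms by simp
  thus "zv (hex_ridge u) 3 = depth t"
    "zv (hex_ridge u) li = 0" "zv (hex_ridge u) ai = depth (inner_coord t 1)"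
    "zv (hex_ridge u) lj = 1" "zv (hex_ridge u) aj = depth (inner_coord t (-1))"
    "zv (hex_ridge u) lk = depth t" "zv (hex_ridge u) ak = depth t"
    using assms by (simp_all add: hex_ridge_def zv_star_arm[OF A(1)] zv_star_arm[OF A(2)]
        zv_star_arm[OF A(3)] depth_eqs inner_coord_eqs)
qed

text \<open>The two disjuncts of \<open>ridge\<close> become the halves \<open>t \<ge> 0\<close> and
  \<open>t \<le> 0\<close> of one edge of the hexagon. The witnesses solve
  \<open>c = 4 - 4 * t\<close> and \<open>c = 4 + 3 * t\<close> respectively.\<close>

lemma ridge_iff_depth:
  "ridge c li ai lj aj lk ak \<longleftrightarrow> (\<exists>t\<in>{-1..1}. c = depth t \<and> li = 0 \<and> ai = depth (inner_coord t 1) \<and>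
     lj = 1 \<and> aj = depth (inner_coord t (-1)) \<and> lk = depth t \<and> ak = depth t)"
proof
  assume r: "ridge c li ai lj aj lk ak"
  then consider "0 \<le> c" "c \<le> 4" "ai = c" "aj = 4" | "1 \<le> c" "c \<le> 4" "ai = 4" "aj = c"
    by (auto simp: ridge_def)
  thus "\<exists>t\<in>{-1..1}. c = depth t \<and> li = 0 \<and> ai = depth (inner_coord t 1) \<and>
     lj = 1 \<and> aj = depth (inner_coord t (-1)) \<and> lk = depth t \<and> ak = depth t"
  proof cases
    case 1
    thus ?thesis using r by (intro bexI[of _ "1 - c / 4"]) (auto simp: ridge_def inner_coord_eqs depth_eqs)
  next
    case 2
    thus ?thesis using r by (intro bexI[of _ "c / 3 - 4 / 3"]) (auto simp: ridge_def inner_coord_eqs depth_eqs)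
  qed
next
  assume "\<exists>t\<in>{-1..1}. c = depth t \<and> li = 0 \<and> ai = depth (inner_coord t 1) \<and>
     lj = 1 \<and> aj = depth (inner_coord t (-1)) \<and> lk = depth t \<and> ak = depth t"
  then obtain t where t: "-1 \<le> t" "t \<le> 1" "c = depth t" "li = 0" "ai = depth (inner_coord t 1)"
     "lj = 1" "aj = depth (inner_coord t (-1))" "lk = depth t" "ak = depth t" by auto
  show "ridge c li ai lj aj lk ak"
    using t by (cases "0 \<le> t") (auto simp: ridge_def inner_coord_eqs depth_eqs)
qed

lemma hex_ridge_image: "hex_ridge ` hexagon = ridges"
proof (intro equalityI subsetI)
  fix z assume "z \<in> hex_ridge ` hexagon"
  then obtain u where z: "z = hex_ridge u" and "u \<in> hexagon" by blast
  then obtain li ai lj aj lk ak where arms: "arms li ai lj aj lk ak" and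
    v: "hex_coord u li = 1" "hex_coord u lj = -1" "hex_coord u lk \<in> {-1..1}"
    unfolding hexagon_iff by blast
  have "ridge (zv z 3) (zv z li) (zv z ai) (zv z lj) (zv z aj) (zv z lk) (zv z ak)"
    unfolding ridge_iff_depth z using hex_ridge_coords[OF arms v(1,2) refl] v(3) by blast
  thus "z \<in> ridges" using arms unfolding ridges_def by blast
next
  fix z assume "z \<in> ridges"
  then obtain li ai lj aj lk ak where arms: "arms li ai lj aj lk ak" and
    "ridge (zv z 3) (zv z li) (zv z ai) (zv z lj) (zv z aj) (zv z lk) (zv z ak)"
    unfolding ridges_def by blast
  then obtain t where t: "t \<in> {-1..1}" "zv z 3 = depth t" "zv z li = 0" "zv z ai = depth (inner_coord t 1)"
     "zv z lj = 1" "zv z aj = depth (inner_coord t (-1))" "zv z lk = depth t" "zv z ak = depth t"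
    unfolding ridge_iff_depth by blast
  \<comment> \<open>The signed leaf heights: the arms \<open>i\<close> and \<open>j\<close> carry
    the two bottoms, the third leaf has the height of the centre.\<close>
  define f where "f l = (if l = li then 1 else if l = lj then -1 else t)" for l
  define u where "u = (f 1, f 5, f 7)"
  have f: "hex_coord u l = f l" if "arm l a" for l a
    using that by (auto simp: arm_def u_def hex_coord_def)
  have v: "hex_coord u li = 1" "hex_coord u lj = -1" "hex_coord u lk = t"
    using f arms by (auto simp: arms_def f_def)
  hence "u \<in> hexagon" using arms t(1) unfolding hexagon_iff by blast
  moreover have "z = hex_ridge u"
  proof (rule star_ext)
    show "zv z 3 = zv (hex_ridge u) 3" using hex_ridge_coords[OF arms v] t by simp
    fix l a assume "arm l a"
    from arms_exhaust[OF arms this] show "zv z l = zv (hex_ridge u) l \<and> zv z a = zv (hex_ridge u) a"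
      using hex_ridge_coords[OF arms v] t by auto
  qed
  ultimately show "z \<in> hex_ridge ` hexagon" by blast
qed

lemma hexagon_coord_values:
  assumes "u \<in> hexagon"
  shows "hex_sum u \<in> {-1..1}" "arm l a \<Longrightarrow> hex_coord u l \<in> {1, -1, hex_sum u}"
    "\<exists>l a. arm l a \<and> hex_coord u l = -1"
proof -
  obtain li ai lj aj lk ak where arms: "arms li ai lj aj lk ak" and
    v: "hex_coord u li = 1" "hex_coord u lj = -1" "hex_coord u lk \<in> {-1..1}"
    using assms unfolding hexagon_iff by blast
  have s: "hex_sum u = hex_coord u lk" using hex_sum_arms[OF arms] v by simp
  show "hex_sum u \<in> {-1..1}" using s v by simp
  show "hex_coord u l \<in> {1, -1, hex_sum u}" if "arm l a"
    using arms_exhaust[OF arms that] s v by auto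
  show "\<exists>l a. arm l a \<and> hex_coord u l = -1"
    using arms v by (auto simp: arms_def)
qed

lemma hex_ridge_eq_imp:
  assumes "hex_ridge u = hex_ridge v"
  shows "depth (hex_sum u) = depth (hex_sum v)"
    "arm l a \<Longrightarrow> depth (hex_coord u l) = depth (hex_coord v l)"
    "arm l a \<Longrightarrow> depth (inner_coord (hex_sum u) (hex_coord u l)) = depth (inner_coord (hex_sum v) (hex_coord v l))"
proof -
  show "depth (hex_sum u) = depth (hex_sum v)"
    using arg_cong[OF assms, of "\<lambda>z. zv z 3"] by (simp add: hex_ridge_def)
  show "depth (hex_coord u l) = depth (hex_coord v l)" if "arm l a"
    using arg_cong[OF assms, of "\<lambda>z. zv z l"] by (simp add: hex_ridge_def zv_star_arm[OF that])
  show "depth (inner_coord (hex_sum u) (hex_coord u l)) = depth (inner_coord (hex_sum v) (hex_coord v l))" if "arm l a"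
    using arg_cong[OF assms, of "\<lambda>z. zv z a"] by (simp add: hex_ridge_def zv_star_arm[OF that])
qed

text \<open>\<open>depth\<close> is two-to-one, so the sign of the centre has to be read off the arm whose inner
  vertex has value \<open>4\<close>: its leaf has value \<open>1\<close> or \<open>0\<close> according to that sign.\<close>
lemma hex_sum_sign:
  assumes "u \<in> hexagon" "v \<in> hexagon" "hex_ridge u = hex_ridge v" "0 < hex_sum u"
  shows "0 \<le> hex_sum v"
proof (rule ccontr)
  assume "\<not> 0 \<le> hex_sum v"
  hence t': "hex_sum v < 0" "-1 \<le> hex_sum v" using hexagon_coord_values(1)[OF assms(2)] by auto
  have t: "hex_sum u \<le> 1" using hexagon_coord_values(1)[OF assms(1)] by auto
  obtain l a where l: "arm l a" "hex_coord u l = -1" using hexagon_coord_values(3)[OF assms(1)] by blast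
  have "depth (hex_coord v l) = 1" "depth (inner_coord (hex_sum v) (hex_coord v l)) = 4"
    using hex_ridge_eq_imp(2,3)[OF assms(3) l(1)] l(2) assms(4) t by (auto simp: depth_eqs inner_coord_eqs)
  \<comment> \<open>With a negative centre, leaf value 1 forces coordinate -1, and then the inner
    value is that of the centre and lies below 4.\<close>
  thus False using hexagon_coord_values(2)[OF assms(2) l(1)] t' by (auto simp: depth_eqs inner_coord_eqs)
qed

lemma inj_on_hex_ridge: "inj_on hex_ridge hexagon"
proof (rule inj_onI)
  fix u v assume uv: "u \<in> hexagon" "v \<in> hexagon" and eq: "hex_ridge u = hex_ridge v"
  have "hex_sum u = hex_sum v"
    using hex_ridge_eq_imp(1)[OF eq] hex_sum_sign[OF uv eq] hex_sum_sign[OF uv(2,1) eq[symmetric]]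
    by (cases "0 < hex_sum u"; cases "0 < hex_sum v") (auto simp: depth_eqs)
  \<comment> \<open>Leaf values alone do not suffice, since \<open>depth (3/4) = depth (-1)\<close>.
    The inner value decides: it is \<open>depth t\<close> for coordinate \<open>t\<close>, but 4 for
    a coordinate of sign opposite to \<open>t\<close>.\<close>
  moreover have "x = y" if "x \<in> {1, -1, t}" "y \<in> {1, -1, t}" "t \<in> {-1..1}" "depth x = depth y"
    "depth (inner_coord t x) = depth (inner_coord t y)" for x y t
    using that by (cases "0 \<le> t") (auto simp: depth_eqs inner_coord_eqs)
  ultimately have "hex_coord u l = hex_coord v l" if "arm l a" for l a
    using hexagon_coord_values(1,2)[OF uv(1)] hexagon_coord_values(2)[OF uv(2)]
      hex_ridge_eq_imp(2,3)[OF eq] that by metis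
  from this[of 1 2] this[of 5 4] this[of 7 6] show "u = v"
    by (auto simp: arm_def hex_coord_def prod_eq_iff)
qed

text \<open>A continuous injection of a compact space into a Hausdorff space is a homeomorphism onto
  its image, so no inverse has to be constructed.\<close>

lemma sphere_homeomorphic_ridges: "sphere (0::complex) 1 homeomorphic ridges"
proof (rule homeomorphic_compact)
  show "continuous_on (sphere 0 1) (hex_ridge \<circ> hex_proj)"
    by (intro continuous_on_compose continuous_on_hex_proj continuous_on_hex_ridge)
  show "(hex_ridge \<circ> hex_proj) ` sphere 0 1 = ridges"
    unfolding image_comp[symmetric] hex_proj_image hex_ridge_image ..
  show "inj_on (hex_ridge \<circ> hex_proj) (sphere 0 1)"
    by (rule comp_inj_on) (simp_all add: inj_on_hex_proj hex_proj_image inj_on_hex_ridge)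
qed simp

theorem theorem7p5:
  shows "data_P homotopy_eqv sphere (0::complex) 1"
  by (rule homotopy_eqv_trans[OF data_P_homotopy_eqv_ridges
        homeomorphic_imp_homotopy_eqv[OF sphere_homeomorphic_ridges[THEN homeomorphic_sym[THEN iffD1]]]])

end
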